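(* Let $d\ge 1$ be an integer, $\sigma\in[1,\infty]$, $0<r\le 1/2$, and let $n\ge q\ge 2$ be integers. Let $\Theta(Q_n^{(\sigma,d)}(r),q)$ denote the probability that a fixed labeled cycle of length $q$ is present in the geometric random graph $Q_n^{(\sigma,d)}(r)$. Then \[ \Theta(Q_n^{(\sigma,d)}(r),q)=\begin{cases}\beta_{d,\sigma,r} & \text{if } q=2,\\[2pt] \displaystyle\sum_{\mathbf m\in\mathbb Z^d}\hat{\Xi}_{B_{d,\sigma,r}(\mathbf 0)}(2\pi\mathbf m)^q & \text{if } q>2.\end{cases} \]
   Context: The $d$-dimensional unit torus is $T_d=\mathbb R^d/\mathbb Z^d$ (identified with $[0,1]^d$). For $\sigma\in[1,\infty]$ and $r>0$, $B_{d,\sigma,r}(\mathbf 0)=\{\mathbf x\in\mathbb R^d:\|\mathbf x\|_\sigma\le r\}$, with $\|\cdot\|_\sigma$ the $L_\sigma$ norm. The geometric random graph $Q_n^{(\sigma,d)}(r)$ has vertex set $\{1,\dots,n\}$, where vertex $i$ is associated with a point $\mathbf x_i$, the points $\mathbf x_1,\dots,\mathbf x_n$ being independent and uniformly distributed in $T_d$; distinct vertices $i,j$ are adjacent iff $\|\mathbf x_i-\mathbf x_j\|_\sigma\le r$, where the distance is measured on the torus, i.e. $\min_{\mathbf u\in\mathbb Z^d}\|\mathbf x_i-\mathbf x_j-\mathbf u\|_\sigma\le r$. $\beta_{d,\sigma,r}$ is the probability that two given vertices are adjacent; for $0<r\le1/2$ it equals the Lebesgue volume of $B_{d,\sigma,r}(\mathbf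 0)$. A labeled cycle of length $q$ is a sequence of distinct vertices $y_1,\dots,y_q$; it is present if $\{y_i,y_{i+1}\}$ is an edge for $i=1,\dots,q-1$ and $\{y_q,y_1\}$ is an edge (for $q=2$ this is a single edge). $\Xi_S$ denotes the indicator function of $S\subset\mathbb R^d$, and the Fourier transform of an integrable $f:\mathbb R^d\to\mathbb R$ is $\hat f(\boldsymbol\omega)=\int_{\mathbb R^d}e^{-i\boldsymbol\omega\cdot\mathbf x}f(\mathbf x)\,d\mathbf x$. *)

theory Defs
  imports "HOL-Probability.Probability"
begin

definition L_norm :: "ereal \<Rightarrow> real ^ 'd \<Rightarrow> real" where
  "L_norm \<sigma> x =
     (if \<sigma> = \<infinity> then Max (range (\<lambda>k. \<bar>x $ k\<bar>))
      else (\<Sum>k\<in>UNIV. \<bar>x $ k\<bar> powr real_of_ereal \<sigma>) powr (1 / real_of_ereal \<sigma>))"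

definition L_ball :: "ereal \<Rightarrow> real \<Rightarrow> (real ^ 'd) set" where
  "L_ball \<sigma> r = {x. L_norm \<sigma> x \<le> r}"

definition lattice_vec :: "int ^ 'd \<Rightarrow> real ^ 'd" where
  "lattice_vec m = (\<chi> k. of_int (m $ k))"

text \<open>Points of the torus are represented by arbitrary representatives in \<open>\<real>\<^sup>d\<close>.
  The infimum is a minimum, since only finitely many lattice translates of a point
  lie in any given ball.\<close>

definition torus_dist :: "ereal \<Rightarrow> real ^ 'd \<Rightarrow> real ^ 'd \<Rightarrow> real" where
  "torus_dist \<sigma> x y = (INF u. L_norm \<sigma> (x - y - lattice_vec u))"

definition torus_uniform :: "(real ^ 'd) measure" where
  "torus_uniform = uniform_measure lborel (cbox 0 1)"

definition geometric_graph_edges ::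
    "ereal \<Rightarrow> real \<Rightarrow> nat \<Rightarrow> (nat \<Rightarrow> real ^ 'd) \<Rightarrow> nat set set" where
  "geometric_graph_edges \<sigma> r n x =
     {{i, j} | i j. i \<in> {1..n} \<and> j \<in> {1..n} \<and> i \<noteq> j \<and> torus_dist \<sigma> (x i) (x j) \<le> r}"

definition edge_probability :: "('d :: finite) itself \<Rightarrow> ereal \<Rightarrow> real \<Rightarrow> real" where
  "edge_probability _ \<sigma> r =
     measure (torus_uniform \<Otimes>\<^sub>M torus_uniform)
       {(x :: real ^ 'd, y). torus_dist \<sigma> x y \<le> r}"

definition labeled_cycle :: "'v set \<Rightarrow> nat \<Rightarrow> 'v list \<Rightarrow> bool" where
  "labeled_cycle V q ys \<longleftrightarrow> length ys = q \<and> distinct ys \<and> set ys \<subseteq> V"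

definition cycle_present :: "'v set set \<Rightarrow> 'v list \<Rightarrow> bool" where
  "cycle_present E ys \<longleftrightarrow>
     (\<forall>i < length ys - 1. {ys ! i, ys ! Suc i} \<in> E) \<and> {last ys, hd ys} \<in> E"

definition cycle_probability :: "'a measure \<Rightarrow> ('a \<Rightarrow> 'v set set) \<Rightarrow> 'v list \<Rightarrow> real" where
  "cycle_probability M G ys = measure M {\<omega> \<in> space M. cycle_present (G \<omega>) ys}"

definition fourier_transform :: "(real ^ 'd \<Rightarrow> real) \<Rightarrow> real ^ 'd \<Rightarrow> complex" where
  "fourier_transform f w =
     (LINT x|lebesgue. exp (- \<i> * complex_of_real (w \<bullet> x)) * complex_of_real (f x))"

end

theory Submission
  imports Defs
begin

text \<open>Let \<open>f\<close> be the indicator of the ball of radius \<open>r\<close> on the torus. Integrating out the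
  vertices of the cycle one by one shows that the cycle probability is the value at \<open>0\<close> of the
  \<open>q\<close>-fold periodic convolution power of \<open>f\<close>, whose Fourier coefficients are the \<open>q\<close>-th powers
  of those of \<open>f\<close>. Since \<open>r \<le> 1/2\<close>, the latter are the values of the Fourier transform of
  the indicator of the ball in \<open>\<real>\<^sup>d\<close> on the dual lattice.

  The Fourier series of a convolution of two bounded functions converges absolutely, by Bessel's
  inequality. The convolution is moreover continuous if one factor is continuous almost
  everywhere, as is \<open>f\<close> because spheres are null sets. As trigonometric polynomials are uniformly
  dense by the Stone-Weierstrass theorem, a continuous function is determined by its Fourier
  coefficients, so the convolution equals its Fourier series everywhere, in particular at \<open>0\<close>.\<close>

subsection \<open>The norms\<close>

lemma L_norm_finite:
  "L_norm (ereal p) x = (\<Sum>k\<in>UNIV. \<bar>x $ k\<bar> powr p) powr (1 / p)"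
  by (simp add: L_norm_def)

lemma L_norm_infinity: "L_norm \<infinity> x = Max (range (\<lambda>k. \<bar>x $ k\<bar>))"
  by (simp add: L_norm_def)

lemma exponent_cases:
  fixes \<sigma> :: ereal
  assumes "1 \<le> \<sigma>"
  obtains (finite) p where "\<sigma> = ereal p" "1 \<le> p" | (infinite) "\<sigma> = \<infinity>"
  using assms by (cases \<sigma>) auto

lemma L_norm_mono:
  fixes x y :: "real ^ 'd"
  assumes "1 \<le> \<sigma>" and le: "\<And>k. \<bar>x $ k\<bar> \<le> \<bar>y $ k\<bar>"
  shows "L_norm \<sigma> x \<le> L_norm \<sigma> y"
  using assms(1)
proof (cases rule: exponent_cases)
  case (finite p)
  have "(\<Sum>k\<in>UNIV. \<bar>x $ k\<bar> powr p) \<le> (\<Sum>k\<in>UNIV. \<bar>y $ k\<bar> powr p)"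
    using finite le by (intro sum_mono powr_mono2) auto
  then show ?thesis
    using finite by (auto simp: L_norm_finite intro!: powr_mono2 sum_nonneg)
next
  case infinite
  have "\<bar>x $ k\<bar> \<le> Max (range (\<lambda>k. \<bar>y $ k\<bar>))" for k
    by (rule order_trans[OF le[of k]]) (auto intro!: Max_ge)
  with infinite show ?thesis
    by (auto simp: L_norm_infinity)
qed

lemma component_le_L_norm:
  fixes x :: "real ^ 'd"
  assumes "1 \<le> \<sigma>"
  shows "\<bar>x $ k\<bar> \<le> L_norm \<sigma> x"
  using assms
proof (cases rule: exponent_cases)
  case (finite p)
  have "\<bar>x $ k\<bar> = (\<bar>x $ k\<bar> powr p) powr (1 / p)"
    using finite by (simp add: powr_powr)
  also have "\<dots> \<le> (\<Sum>k\<in>UNIV. \<bar>x $ k\<bar> powr p) powr (1 / p)"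
    using finite by (intro powr_mono2 member_le_sum) auto
  finally show ?thesis
    by (simp add: finite L_norm_finite)
next
  case infinite
  then show ?thesis
    by (auto simp: L_norm_infinity intro!: Max_ge)
qed

lemma L_norm_cong_abs: "(\<And>k. \<bar>x $ k\<bar> = \<bar>y $ k\<bar>) \<Longrightarrow> L_norm \<sigma> x = L_norm \<sigma> y"
  by (simp add: L_norm_def)

lemma L_norm_minus: "L_norm \<sigma> (- x) = L_norm \<sigma> x"
  by (rule L_norm_cong_abs) simp

lemma L_norm_scaleR:
  fixes x :: "real ^ 'd"
  assumes "1 \<le> \<sigma>" "0 \<le> c"
  shows "L_norm \<sigma> (c *\<^sub>R x) = c * L_norm \<sigma> x"
  using assms(1)
proof (cases rule: exponent_cases)
  case (finite p)
  have "(\<Sum>k\<in>UNIV. \<bar>(c *\<^sub>R x) $ k\<bar> powr p) = c powr p * (\<Sum>k\<in>UNIV. \<bar>x $ k\<bar> powr p)"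
    using assms by (simp add: abs_mult powr_mult sum_distrib_left)
  then show ?thesis
    using finite assms by (simp add: L_norm_finite powr_mult powr_powr sum_nonneg)
next
  case infinite
  have "c * Max (range (\<lambda>k. \<bar>x $ k\<bar>)) = Max ((\<lambda>t. c * t) ` range (\<lambda>k. \<bar>x $ k\<bar>))"
    using assms by (intro mono_Max_commute) (auto intro!: monoI mult_left_mono)
  with infinite show ?thesis
    using assms by (simp add: L_norm_infinity abs_mult image_image)
qed

lemma continuous_on_Max_image:
  fixes g :: "'i \<Rightarrow> 'a::topological_space \<Rightarrow> real"
  assumes "finite I" "I \<noteq> {}" "\<And>i. i \<in> I \<Longrightarrow> continuous_on S (g i)"
  shows "continuous_on S (\<lambda>x. Max ((\<lambda>i. g i x) ` I))"
  using assms
proof (induction I rule: finite_ne_induct)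
  case (insert i F)
  then have "continuous_on S (\<lambda>x. max (g i x) (Max ((\<lambda>i. g i x) ` F)))"
    by (intro continuous_on_max) auto
  with insert show ?case
    by simp
qed auto

lemma continuous_on_L_norm:
  assumes "1 \<le> \<sigma>"
  shows "continuous_on S (L_norm \<sigma> :: real ^ 'd \<Rightarrow> real)"
  using assms
proof (cases rule: exponent_cases)
  case (finite p)
  have "continuous_on S (\<lambda>x :: real ^ 'd. (\<Sum>k\<in>UNIV. \<bar>x $ k\<bar> powr p) powr (1 / p))"
    using finite by (intro continuous_on_powr' continuous_intros) (auto intro!: sum_nonneg)
  then show ?thesis
    by (simp add: finite L_norm_finite[abs_def])
next
  case infinite
  then show ?thesis
    unfolding infinite L_norm_infinity[abs_def]
    by (intro continuous_on_Max_image continuous_intros) auto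
qed

lemma borel_measurable_L_norm:
  "1 \<le> \<sigma> \<Longrightarrow> (L_norm \<sigma> :: real ^ 'd \<Rightarrow> real) \<in> borel_measurable borel"
  by (intro borel_measurable_continuous_onI continuous_on_L_norm)

lemma negligible_L_sphere:
  fixes r :: real
  assumes "1 \<le> \<sigma>" "0 < r"
  shows "negligible {x :: real ^ 'd. L_norm \<sigma> x = r}"
proof (rule starlike_negligible[where a = 0])
  show "closed {x :: real ^ 'd. L_norm \<sigma> x = r}"
    using assms by (intro closed_Collect_eq continuous_on_L_norm continuous_intros)
  show "c = 1" if "0 + c *\<^sub>R x \<in> {x. L_norm \<sigma> x = r}" "0 \<le> c"
    "0 + x \<in> {x. L_norm \<sigma> x = r}" for c and x :: "real ^ 'd"
    using that assms by (simp add: L_norm_scaleR)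
qed

subsection \<open>Integration over the torus\<close>

lemma lattice_vec_nth [simp]: "lattice_vec m $ k = of_int (m $ k)"
  by (simp add: lattice_vec_def)

lemma lattice_vec_add: "lattice_vec (m + n) = lattice_vec m + lattice_vec n"
  and lattice_vec_minus: "lattice_vec (- m) = - lattice_vec m"
  and lattice_vec_0 [simp]: "lattice_vec 0 = 0"
  by (simp_all add: vec_eq_iff)

definition lattice_periodic :: "(real ^ 'd \<Rightarrow> 'b) \<Rightarrow> bool" where
  "lattice_periodic f \<longleftrightarrow> (\<forall>x u. f (x + lattice_vec u) = f x)"

lemma lattice_periodic_add: "lattice_periodic f \<Longrightarrow> f (x + lattice_vec u) = f x"
  by (simp add: lattice_periodic_def)

lemma lattice_periodic_diff: "lattice_periodic f \<Longrightarrow> f (x - lattice_vec u) = f x"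
  using lattice_periodic_add[of f x "- u"] by (simp add: lattice_vec_minus)

lemma lattice_periodic_add_diff: "lattice_periodic f \<Longrightarrow> f (x + lattice_vec u - z) = f (x - z)"
  using lattice_periodic_add[of f "x - z" u] by (simp add: diff_add_eq)

lemma lattice_periodic_diff_add: "lattice_periodic f \<Longrightarrow> f (z - (x + lattice_vec u)) = f (z - x)"
  using lattice_periodic_diff[of f "z - x" u] by (simp add: diff_diff_eq)

lemma lattice_periodic_translate: "lattice_periodic f \<Longrightarrow> lattice_periodic (\<lambda>x. f (x + a))"
  by (simp add: lattice_periodic_def add.commute[of _ a] flip: add.assoc)

definition vec_frac :: "real ^ 'd \<Rightarrow> real ^ 'd" where
  "vec_frac x = (\<chi> k. frac (x $ k))"

lemma vec_frac_eq: "vec_frac x = x - lattice_vec (\<chi> k. \<lfloor>x $ k\<rfloor>)"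
  by (simp add: vec_eq_iff vec_frac_def frac_def)

lemma vec_frac_add_lattice_vec [simp]: "vec_frac (x + lattice_vec u) = vec_frac x"
  by (simp add: vec_frac_def vec_eq_iff)

lemma lattice_periodic_apply_vec_frac: "lattice_periodic f \<Longrightarrow> f (vec_frac x) = f x"
  by (simp add: vec_frac_eq lattice_periodic_diff)

lemma lattice_periodic_range:
  assumes "lattice_periodic f"
  shows "range f = f ` cbox 0 1"
proof -
  have "f x \<in> f ` cbox 0 1" for x
  proof (rule image_eqI)
    show "f x = f (vec_frac x)"
      using assms by (simp add: lattice_periodic_apply_vec_frac)
    show "vec_frac x \<in> cbox 0 1"
      by (simp add: mem_box_cart vec_frac_def frac_lt_1 less_imp_le)
  qed
  then show ?thesis
    by blast
qed

lemma borel_measurable_vec_frac [measurable]: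
  "(vec_frac :: real ^ 'd \<Rightarrow> real ^ 'd) \<in> borel_measurable borel"
proof (rule borel_measurable_euclidean_space[THEN iffD2], rule ballI)
  fix i :: "real ^ 'd" assume "i \<in> Basis"
  then obtain k where "i = axis k 1"
    by (auto simp: Basis_vec_def)
  then have "(\<lambda>x. vec_frac x \<bullet> i) = (\<lambda>x. frac (x $ k))"
    by (simp add: vec_frac_def inner_axis fun_eq_iff)
  then show "(\<lambda>x. vec_frac x \<bullet> i) \<in> borel_measurable borel"
    by (simp add: frac_def)
qed

definition unit_cell :: "real ^ 'd \<Rightarrow> (real ^ 'd) set" where
  "unit_cell a = {x. \<forall>k. a $ k \<le> x $ k \<and> x $ k < a $ k + 1}"

lemma sets_unit_cell [measurable]: "unit_cell a \<in> sets borel"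
  unfolding unit_cell_def by measurable

lemma vec_frac_unit_cell: "x \<in> unit_cell 0 \<Longrightarrow> vec_frac x = x"
  by (simp add: unit_cell_def vec_eq_iff vec_frac_def frac_eq)

lemma unit_cell_translate_iff:
  "x + lattice_vec u \<in> unit_cell a \<longleftrightarrow> u = (\<chi> k. \<lceil>a $ k - x $ k\<rceil>)"
proof -
  have "a $ k \<le> x $ k + of_int (u $ k) \<and> x $ k + of_int (u $ k) < a $ k + 1 \<longleftrightarrow>
      u $ k = \<lceil>a $ k - x $ k\<rceil>" for k
    by linarith
  then show ?thesis
    by (simp add: unit_cell_def vec_eq_iff)
qed

lemma nn_integral_lattice_indicator_unit_cell:
  "(\<integral>\<^sup>+ u. indicator (unit_cell a) (x + lattice_vec u) \<partial>count_space UNIV) = 1"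
proof -
  have "(\<lambda>u. indicator (unit_cell a) (x + lattice_vec u) :: ennreal) =
      indicator {\<chi> k. \<lceil>a $ k - x $ k\<rceil>}"
    by (simp add: fun_eq_iff indicator_def unit_cell_translate_iff)
  then show ?thesis
    by simp
qed

lemma nn_integral_lborel_translate:
  fixes a :: "'a::euclidean_space"
  assumes [measurable]: "g \<in> borel_measurable borel"
  shows "(\<integral>\<^sup>+ x. g (x + a) \<partial>lborel) = (\<integral>\<^sup>+ x. g x \<partial>lborel)"
proof -
  have "(\<integral>\<^sup>+ x. g x \<partial>lborel) = (\<integral>\<^sup>+ x. g x \<partial>distr lborel borel ((+) a))"
    by (simp add: lborel_distr_plus)
  also have "\<dots> = (\<integral>\<^sup>+ x. g (x + a) \<partial>lborel)"
    by (subst nn_integral_distr) (auto simp: add.commute)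
  finally show ?thesis ..
qed

text \<open>Cut one cell along the lattice translates of the other and move the pieces back.\<close>

lemma nn_integral_unit_cell_eq:
  fixes g :: "real ^ 'd \<Rightarrow> ennreal"
  assumes [measurable]: "g \<in> borel_measurable borel" and "lattice_periodic g"
  shows "(\<integral>\<^sup>+ x \<in> unit_cell a. g x \<partial>lborel) = (\<integral>\<^sup>+ x \<in> unit_cell b. g x \<partial>lborel)"
proof -
  let ?L = "count_space (UNIV :: (int ^ 'd) set)"
  let ?piece = "\<lambda>u x. g x * indicator (unit_cell a) x * indicator (unit_cell b) (x + lattice_vec u)"
  let ?moved = "\<lambda>u x. g x * indicator (unit_cell b) x * indicator (unit_cell a) (x + lattice_vec u)"
  have "(\<integral>\<^sup>+ x \<in> unit_cell a. g x \<partial>lborel) = (\<integral>\<^sup>+ x. \<integral>\<^sup>+ u. ?piece u x \<partial>?L \<partial>lborel)"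
    by (simp add: nn_integral_cmult nn_integral_lattice_indicator_unit_cell)
  also have "\<dots> = (\<integral>\<^sup>+ u. \<integral>\<^sup>+ x. ?piece u x \<partial>lborel \<partial>?L)"
    by (intro nn_integral_count_space_nn_integral) auto
  also have "\<dots> = (\<integral>\<^sup>+ u. \<integral>\<^sup>+ x. ?moved (- u) x \<partial>lborel \<partial>?L)"
  proof (rule nn_integral_cong)
    fix u
    have "?piece u x = ?moved (- u) (x + lattice_vec u)" for x
      using assms(2) by (simp add: lattice_periodic_add lattice_vec_minus mult_ac)
    moreover have "(\<integral>\<^sup>+ x. ?moved (- u) (x + lattice_vec u) \<partial>lborel) =
        (\<integral>\<^sup>+ x. ?moved (- u) x \<partial>lborel)"
      by (rule nn_integral_lborel_translate) measurable
    ultimately show "(\<integral>\<^sup>+ x. ?piece u x \<partial>lborel) = (\<integral>\<^sup>+ x. ?moved (- u) x \<partial>lborel)"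
      by (simp only:)
  qed
  also have "\<dots> = (\<integral>\<^sup>+ u. \<integral>\<^sup>+ x. ?moved u x \<partial>lborel \<partial>?L)"
    by (rule nn_integral_bij_count_space[OF bij_uminus])
  also have "\<dots> = (\<integral>\<^sup>+ x. \<integral>\<^sup>+ u. ?moved u x \<partial>?L \<partial>lborel)"
    by (intro nn_integral_count_space_nn_integral[symmetric]) auto
  also have "\<dots> = (\<integral>\<^sup>+ x \<in> unit_cell b. g x \<partial>lborel)"
    by (simp add: nn_integral_cmult nn_integral_lattice_indicator_unit_cell)
  finally show ?thesis .
qed

lemma AE_lborel_not_in_negligible: "negligible S \<Longrightarrow> AE x in lborel. x \<notin> S"
  using AE_not_in[of S lebesgue] by (simp add: negligible_iff_null_sets AE_completion_iff)

lemma AE_unit_cell: "AE x in lborel. x \<in> cbox a (a + 1) \<longleftrightarrow> x \<in> unit_cell (a :: real ^ 'd)"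
  using AE_lborel_not_in_negligible[OF negligible_frontier_interval[of a "a + 1"]]
proof eventually_elim
  case (elim x)
  have "x \<in> box a (a + 1) \<Longrightarrow> x \<in> unit_cell a" "x \<in> unit_cell a \<Longrightarrow> x \<in> cbox a (a + 1)"
    by (auto simp: mem_box_cart unit_cell_def less_imp_le)
  with elim show ?case
    by blast
qed

lemma emeasure_unit_cube: "emeasure lborel (cbox 0 1 :: (real ^ 'd) set) = 1"
proof -
  have "(0 :: real ^ 'd) \<in> cbox 0 1"
    by (simp add: mem_box_cart)
  then have "measure lborel (cbox 0 1 :: (real ^ 'd) set) = 1"
    using content_cbox_cart[of "0 :: real ^ 'd" 1] by auto
  then show ?thesis
    using emeasure_eq_ennreal_measure[of lborel "cbox 0 1 :: (real ^ 'd) set"]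
      emeasure_lborel_cbox_finite[of "0 :: real ^ 'd" 1] by (simp add: less_top)
qed

lemma torus_uniform_eq_density: "torus_uniform = density lborel (indicator (cbox 0 1))"
  unfolding torus_uniform_def uniform_measure_def
  by (simp add: emeasure_unit_cube divide_ennreal_def)

lemma sets_torus_uniform [measurable_cong, simp]: "sets torus_uniform = sets borel"
  by (simp add: torus_uniform_def)

lemma space_torus_uniform [simp]: "space torus_uniform = UNIV"
  by (simp add: torus_uniform_def)

interpretation torus: prob_space "torus_uniform :: (real ^ 'd) measure"
  unfolding torus_uniform_def
  by (intro prob_space_uniform_measure) (simp_all add: emeasure_unit_cube)

lemma AE_torus_uniformI: "AE x in lborel. P x \<Longrightarrow> AE x in torus_uniform. P x"
  unfolding torus_uniform_def by (rule AE_uniform_measureI) auto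

lemma distr_vec_frac_unit_cube:
  "distr (density lborel (indicator (cbox a (a + 1)))) borel vec_frac =
    (torus_uniform :: (real ^ 'd) measure)"
proof (rule measure_eqI)
  fix A :: "(real ^ 'd) set"
  assume "A \<in> sets (distr (density lborel (indicator (cbox a (a + 1)))) borel vec_frac)"
  then have A [measurable]: "A \<in> sets borel"
    by simp
  have cube_eq_cell: "(\<integral>\<^sup>+ x \<in> cbox c (c + 1). g x \<partial>lborel) = (\<integral>\<^sup>+ x \<in> unit_cell c. g x \<partial>lborel)"
    for c :: "real ^ 'd" and g
    by (rule nn_integral_cong_AE) (use AE_unit_cell in eventually_elim, auto simp: indicator_def)
  have "emeasure (distr (density lborel (indicator (cbox a (a + 1)))) borel vec_frac) A =
      (\<integral>\<^sup>+ x. indicator A x \<partial>distr (density lborel (indicator (cbox a (a + 1)))) borel vec_frac)"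
    by simp
  also have "\<dots> = (\<integral>\<^sup>+ x \<in> cbox a (a + 1). indicator A (vec_frac x) \<partial>lborel)"
    by (simp add: nn_integral_distr nn_integral_density mult.commute del: nn_integral_indicator)
  also have "\<dots> = (\<integral>\<^sup>+ x \<in> unit_cell 0. indicator A (vec_frac x) \<partial>lborel)"
    unfolding cube_eq_cell by (intro nn_integral_unit_cell_eq) (auto simp: lattice_periodic_def)
  also have "\<dots> = (\<integral>\<^sup>+ x \<in> unit_cell 0. indicator A x \<partial>lborel)"
    by (intro nn_integral_cong) (auto simp: indicator_def vec_frac_unit_cell)
  also have "\<dots> = emeasure torus_uniform A"
    using cube_eq_cell[where c = 0] by (simp add: torus_uniform_eq_density emeasure_density mult.commute)
  finally show "emeasure (distr (density lborel (indicator (cbox a (a + 1)))) borel vec_frac) A =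
      emeasure torus_uniform A" .
qed simp

lemma integral_torus_eq_unit_cube:
  fixes g :: "real ^ 'd \<Rightarrow> 'b::{banach,second_countable_topology}"
  assumes [measurable]: "g \<in> borel_measurable borel" and "lattice_periodic g"
  shows "(\<integral>x. g x \<partial>torus_uniform) = (LINT x : cbox a (a + 1) | lborel. g x)"
proof -
  let ?cube = "density lborel (\<lambda>x. ennreal (indicat_real (cbox a (a + 1)) x))"
  have "(\<integral>x. g x \<partial>torus_uniform) = (\<integral>x. g x \<partial>distr ?cube borel vec_frac)"
    using distr_vec_frac_unit_cube[of a] by (simp add: ennreal_indicator)
  also have "\<dots> = (\<integral>x. g x \<partial>?cube)"
    using assms by (simp add: integral_distr lattice_periodic_apply_vec_frac)
  also have "\<dots> = (LINT x : cbox a (a + 1) | lborel. g x)"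
    unfolding set_lebesgue_integral_def by (rule integral_density) auto
  finally show ?thesis .
qed

lemma integral_torus_translate:
  fixes g :: "real ^ 'd \<Rightarrow> 'b::{banach,second_countable_topology}"
  assumes [measurable]: "g \<in> borel_measurable borel" and "lattice_periodic g"
  shows "(\<integral>x. g (x + a) \<partial>torus_uniform) = (\<integral>x. g x \<partial>torus_uniform)"
proof -
  let ?cube = "\<lambda>c :: real ^ 'd. cbox c (c + 1)"
  have shift: "indicat_real (?cube a) (a + x) *\<^sub>R g (a + x) =
      indicat_real (?cube 0) x *\<^sub>R g (x + a)" for x
    by (simp add: indicator_def mem_box_cart add.commute)
  have "(\<integral>x. g x \<partial>torus_uniform) = (LINT x : ?cube a | lborel. g x)"
    using assms by (rule integral_torus_eq_unit_cube)
  also have "\<dots> = (LINT x : ?cube a | distr lborel borel ((+) a). g x)"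
    by (simp add: lborel_distr_plus)
  also have "\<dots> = (LINT x : ?cube 0 | lborel. g (x + a))"
    unfolding set_lebesgue_integral_def
    by (subst integral_distr) (auto simp: shift simp del: add_0)
  also have "\<dots> = (\<integral>x. g (x + a) \<partial>torus_uniform)"
    using assms(2)
    by (intro integral_torus_eq_unit_cube[symmetric] lattice_periodic_translate) measurable
  finally show ?thesis ..
qed

definition bounded_torus_fun :: "(real ^ 'd \<Rightarrow> complex) \<Rightarrow> bool" where
  "bounded_torus_fun g \<longleftrightarrow>
    g \<in> borel_measurable borel \<and> lattice_periodic g \<and> bounded (range g)"

lemma bounded_torus_fun_measurable: "bounded_torus_fun g \<Longrightarrow> g \<in> borel_measurable borel"
  and bounded_torus_fun_periodic: "bounded_torus_fun g \<Longrightarrow> lattice_periodic g"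
  by (simp_all add: bounded_torus_fun_def)

lemma bounded_torus_fun_bound:
  assumes "bounded_torus_fun g"
  obtains B where "0 \<le> B" "\<And>x. norm (g x) \<le> B"
  using assms by (auto simp: bounded_torus_fun_def bounded_pos intro: less_imp_le)

lemma bounded_torus_fun_mult_bound:
  assumes "bounded_torus_fun f" "bounded_torus_fun g"
  obtains B where "\<And>x y. norm (f x * g y) \<le> B"
proof -
  obtain B C where "0 \<le> B" "\<And>x. norm (f x) \<le> B" "\<And>x. norm (g x) \<le> C"
    using bounded_torus_fun_bound assms by metis
  then have "norm (f x * g y) \<le> B * C" for x y
    by (simp add: norm_mult mult_mono)
  then show thesis
    by (rule that)
qed

lemma integrable_bounded_torus_fun:
  assumes "bounded_torus_fun g"
  shows "integrable torus_uniform g"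
proof -
  obtain B where "\<And>x. norm (g x) \<le> B"
    using bounded_torus_fun_bound[OF assms] by blast
  then show ?thesis
    using bounded_torus_fun_measurable[OF assms]
    by (intro torus.integrable_const_bound[of _ B]) auto
qed

lemma square_integrable_bounded_torus_fun:
  assumes "bounded_torus_fun g"
  shows "integrable torus_uniform (\<lambda>x. (norm (g x))\<^sup>2)"
proof -
  note [measurable] = bounded_torus_fun_measurable[OF assms]
  obtain B where "\<And>x. norm (g x) \<le> B"
    using bounded_torus_fun_bound[OF assms] by blast
  then show ?thesis
    by (intro torus.integrable_const_bound[of _ "B\<^sup>2"]) (auto intro!: power_mono)
qed

lemma continuous_periodic_imp_bounded_torus_fun:
  assumes "continuous_on UNIV g" "lattice_periodic g"
  shows "bounded_torus_fun g"
proof -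
  have "bounded (range g)"
    unfolding lattice_periodic_range[OF assms(2)] using assms(1)
    by (intro compact_imp_bounded compact_continuous_image) (auto intro: continuous_on_subset)
  then show ?thesis
    using assms by (simp add: bounded_torus_fun_def borel_measurable_continuous_onI)
qed

lemma continuous_torus_integral_0_imp_0:
  fixes g :: "real ^ 'd \<Rightarrow> real"
  assumes "continuous_on UNIV g" "lattice_periodic g" "\<And>x. 0 \<le> g x"
    and "(\<integral>x. g x \<partial>torus_uniform) = 0"
  shows "g x = 0"
proof (rule has_integral_0_cbox_imp_0[where a = x and b = "x + 1"])
  let ?cube = "cbox x (x + 1)"
  show cont: "continuous_on ?cube g"
    using assms(1) by (rule continuous_on_subset) simp
  have "set_integrable lborel ?cube g"
    unfolding set_integrable_def by (intro borel_integrable_compact cont) auto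
  moreover have "(LINT y : ?cube | lborel. g y) = 0"
    using integral_torus_eq_unit_cube[OF borel_measurable_continuous_onI assms(2)] assms(1,4)
    by simp
  ultimately show "(g has_integral 0) ?cube"
    using set_borel_integral_eq_integral[of ?cube g] by (simp add: has_integral_iff)
  show "box x (x + 1) \<noteq> {}"
    by (simp add: interval_ne_empty_cart)
  show "x \<in> ?cube"
    by (simp add: mem_box_cart)
qed (rule assms)

subsection \<open>Fourier coefficients\<close>

definition torus_char :: "int ^ 'd \<Rightarrow> real ^ 'd \<Rightarrow> complex" where
  "torus_char m x = cis (2 * pi * (lattice_vec m \<bullet> x))"

lemma norm_torus_char [simp]: "norm (torus_char m x) = 1"
  by (simp add: torus_char_def)

lemma continuous_on_torus_char: "continuous_on S (torus_char m)"
  unfolding torus_char_def by (intro continuous_intros)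

lemma borel_measurable_torus_char [measurable]: "torus_char m \<in> borel_measurable borel"
  by (intro borel_measurable_continuous_onI continuous_on_torus_char)

lemma torus_char_add: "torus_char m (x + y) = torus_char m x * torus_char m y"
  by (simp add: torus_char_def inner_add_right distrib_left cis_mult)

lemma torus_char_add_index: "torus_char (m + n) x = torus_char m x * torus_char n x"
  by (simp add: torus_char_def lattice_vec_add inner_add_left distrib_left cis_mult)

lemma torus_char_0 [simp]: "torus_char m 0 = 1"
  and torus_char_0_index [simp]: "torus_char 0 x = 1"
  by (simp_all add: torus_char_def)

lemma cnj_torus_char: "cnj (torus_char m x) = torus_char (- m) x"
  by (simp add: torus_char_def lattice_vec_minus cis_cnj)

lemma torus_char_lattice_vec: "torus_char m (lattice_vec u) = 1"
proof -
  have "lattice_vec m \<bullet> lattice_vec u = of_int (\<Sum>k\<in>UNIV. m $ k * u $ k)"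
    by (simp add: inner_vec_def)
  then show ?thesis
    unfolding torus_char_def by (metis cis_multiple_2pi Ints_of_int)
qed

lemma lattice_periodic_torus_char: "lattice_periodic (torus_char m)"
  by (simp add: lattice_periodic_def torus_char_add torus_char_lattice_vec)

text \<open>Translating by a point where the character is \<open>-1\<close> changes the sign of its integral.\<close>

lemma integral_torus_char:
  "(\<integral>x. torus_char m x \<partial>torus_uniform) = (if m = (0 :: int ^ 'd) then 1 else 0)"
proof (cases "m = 0")
  case True
  then show ?thesis
    using torus.prob_space[where 'd = 'd] by simp
next
  case False
  then obtain k where k: "m $ k \<noteq> 0"
    by (auto simp: vec_eq_iff)
  let ?a = "axis k (1 / (2 * of_int (m $ k))) :: real ^ 'd"
  have char_a: "torus_char m ?a = - 1"
    using k by (simp add: torus_char_def inner_axis)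
  have "(\<integral>x. torus_char m x \<partial>torus_uniform) = (\<integral>x. torus_char m (x + ?a) \<partial>torus_uniform)"
    by (intro integral_torus_translate[symmetric] lattice_periodic_torus_char) measurable
  also have "\<dots> = - (\<integral>x. torus_char m x \<partial>torus_uniform)"
    by (simp add: torus_char_add char_a)
  finally show ?thesis
    using False by simp
qed

definition torus_coeff :: "(real ^ 'd \<Rightarrow> complex) \<Rightarrow> int ^ 'd \<Rightarrow> complex" where
  "torus_coeff g m = (\<integral>x. g x * torus_char (- m) x \<partial>torus_uniform)"

lemma integrable_mult_torus_char:
  assumes "integrable torus_uniform g"
  shows "integrable torus_uniform (\<lambda>x. g x * torus_char m x)"
  using assms by (rule Bochner_Integration.integrable_bound) (use assms in \<open>auto simp: norm_mult\<close>)

lemma torus_coeff_diff: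
  assumes "integrable torus_uniform g" "integrable torus_uniform h"
  shows "torus_coeff (\<lambda>x. g x - h x) m = torus_coeff g m - torus_coeff h m"
  using assms[THEN integrable_mult_torus_char, of "- m"]
  by (simp add: torus_coeff_def left_diff_distrib)

lemma norm_torus_coeff_le: "norm (torus_coeff g m) \<le> (\<integral>x. norm (g x) \<partial>torus_uniform)"
  unfolding torus_coeff_def by (rule order_trans[OF integral_norm_bound]) (simp add: norm_mult)

lemma tendsto_torus_coeff:
  assumes "uniform_limit UNIV g h F" "\<forall>\<^sub>F n in F. integrable torus_uniform (g n)"
    and "integrable torus_uniform h"
  shows "((\<lambda>n. torus_coeff (g n) m) \<longlongrightarrow> torus_coeff h m) F"
proof (rule tendstoI)
  fix e :: real assume "0 < e"
  then have "\<forall>\<^sub>F n in F. \<forall>x\<in>UNIV. dist (g n x) (h x) < e / 2"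
    by (intro uniform_limitD[OF assms(1)]) simp
  with assms(2) show "\<forall>\<^sub>F n in F. dist (torus_coeff (g n) m) (torus_coeff h m) < e"
  proof eventually_elim
    case (elim n)
    have "norm (torus_coeff (\<lambda>x. g n x - h x) m) \<le> (\<integral>x. norm (g n x - h x) \<partial>torus_uniform)"
      by (rule norm_torus_coeff_le)
    also have "\<dots> \<le> e / 2"
      using elim assms(3)
      by (intro torus.integral_le_const) (auto simp: dist_norm intro: less_imp_le)
    finally show ?case
      using elim(1) assms(3) \<open>0 < e\<close> by (simp add: torus_coeff_diff dist_norm)
  qed
qed

definition trig_sum :: "(int ^ 'd \<Rightarrow> complex) \<Rightarrow> (int ^ 'd) set \<Rightarrow> real ^ 'd \<Rightarrow> complex" where
  "trig_sum a S x = (\<Sum>m\<in>S. a m * torus_char m x)"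

lemma continuous_on_trig_sum: "continuous_on A (trig_sum a S)"
  unfolding trig_sum_def by (intro continuous_intros continuous_on_torus_char)

lemma borel_measurable_trig_sum [measurable]: "trig_sum a S \<in> borel_measurable borel"
  by (intro borel_measurable_continuous_onI continuous_on_trig_sum)

lemma norm_trig_sum_le: "norm (trig_sum a S x) \<le> (\<Sum>m\<in>S. norm (a m))"
  unfolding trig_sum_def by (rule order_trans[OF norm_sum]) (simp add: norm_mult)

lemma integrable_trig_sum: "integrable torus_uniform (trig_sum a S)"
  by (rule torus.integrable_const_bound[of _ "\<Sum>m\<in>S. norm (a m)"]) (auto simp: norm_trig_sum_le)

lemma torus_coeff_trig_sum:
  assumes "finite S"
  shows "torus_coeff (trig_sum a S) m = (if m \<in> S then a m else 0)"
proof -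
  have "torus_coeff (trig_sum a S) m = (\<integral>x. (\<Sum>n\<in>S. a n * torus_char (n - m) x) \<partial>torus_uniform)"
    by (simp add: torus_coeff_def trig_sum_def sum_distrib_right mult.assoc
        flip: torus_char_add_index)
  also have "\<dots> = (\<Sum>n\<in>S. a n * (if n = m then 1 else 0))"
    by (subst Bochner_Integration.integral_sum)
      (auto simp: integral_torus_char norm_mult intro!: torus.integrable_const_bound)
  also have "\<dots> = (if m \<in> S then a m else 0)"
    using assms by (simp add: if_distrib[of "(*) _"] cong: if_cong)
  finally show ?thesis .
qed

lemma has_bochner_integral_mult_cnj_trig_sum:
  assumes "integrable torus_uniform g"
  shows "has_bochner_integral torus_uniform (\<lambda>x. g x * cnj (trig_sum a S x))
    (\<Sum>m\<in>S. torus_coeff g m * cnj (a m))"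
proof -
  have "has_bochner_integral torus_uniform (\<lambda>x. \<Sum>m\<in>S. g x * torus_char (- m) x * cnj (a m))
      (\<Sum>m\<in>S. torus_coeff g m * cnj (a m))"
    unfolding torus_coeff_def
    by (intro has_bochner_integral_sum has_bochner_integral_mult_left
        has_bochner_integral_integrable integrable_mult_torus_char assms)
  then show ?thesis
    by (simp add: trig_sum_def cnj_torus_char sum_distrib_left mult_ac)
qed

text \<open>Expand \<open>\<integral> |g - p|\<^sup>2 \<ge> 0\<close>, where \<open>p\<close> is the Fourier sum of \<open>g\<close> over \<open>S\<close>.\<close>

lemma Bessel_inequality_torus:
  assumes [measurable]: "g \<in> borel_measurable borel"
    and square_integrable: "integrable torus_uniform (\<lambda>x. (norm (g x))\<^sup>2)"
    and "finite S"
  shows "(\<Sum>m\<in>S. (norm (torus_coeff g m))\<^sup>2) \<le> (\<integral>x. (norm (g x))\<^sup>2 \<partial>torus_uniform)"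
proof -
  define p where "p = trig_sum (torus_coeff g) S"
  let ?s = "\<Sum>m\<in>S. (norm (torus_coeff g m))\<^sup>2"
  have integrable_g: "integrable torus_uniform g"
    using torus.square_integrable_imp_integrable[OF _ square_integrable]
    by (simp add: integrable_norm_iff)
  have inner_p: "has_bochner_integral torus_uniform (\<lambda>x. Re (h x * cnj (p x))) ?s"
    if "integrable torus_uniform h" "\<And>m. m \<in> S \<Longrightarrow> torus_coeff h m = torus_coeff g m" for h
  proof -
    have "(\<Sum>m\<in>S. torus_coeff h m * cnj (torus_coeff g m)) = of_real ?s"
      using that(2) by (simp flip: complex_norm_square)
    then show ?thesis
      using has_bochner_integral_Re[OF has_bochner_integral_mult_cnj_trig_sum[OF that(1)]]
      unfolding p_def by (metis Re_complex_of_real)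
  qed
  have g_p: "has_bochner_integral torus_uniform (\<lambda>x. Re (g x * cnj (p x))) ?s"
    by (intro inner_p integrable_g refl)
  have p_p: "has_bochner_integral torus_uniform (\<lambda>x. Re (p x * cnj (p x))) ?s"
    using \<open>finite S\<close>
    by (intro inner_p) (simp_all add: p_def integrable_trig_sum torus_coeff_trig_sum)
  have "0 \<le> (\<integral>x. (norm (g x - p x))\<^sup>2 \<partial>torus_uniform)"
    by simp
  also have "\<dots> = (\<integral>x. (norm (g x))\<^sup>2 - 2 * Re (g x * cnj (p x)) +
      Re (p x * cnj (p x)) \<partial>torus_uniform)"
    unfolding cmod_power2
    by (intro Bochner_Integration.integral_cong) (auto simp: power2_eq_square algebra_simps)
  also have "\<dots> = (\<integral>x. (norm (g x))\<^sup>2 \<partial>torus_uniform) - 2 * ?s + ?s"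
    by (intro has_bochner_integral_integral_eq has_bochner_integral_add has_bochner_integral_diff
        has_bochner_integral_mult_right has_bochner_integral_integrable square_integrable g_p p_p)
  finally show ?thesis
    by simp
qed

lemma square_summable_torus_coeff:
  assumes "g \<in> borel_measurable borel" "integrable torus_uniform (\<lambda>x. (norm (g x))\<^sup>2)"
  shows "(\<lambda>m. (norm (torus_coeff g m))\<^sup>2) summable_on UNIV"
  using Bessel_inequality_torus[OF assms]
  by (intro nonneg_bdd_above_summable_on) (auto simp: bdd_above_def)

subsection \<open>Density of the trigonometric polynomials\<close>

inductive trig_polynomial :: "(real ^ 'd \<Rightarrow> complex) \<Rightarrow> bool" where
  char: "trig_polynomial (torus_char m)"
| scale: "trig_polynomial p \<Longrightarrow> trig_polynomial (\<lambda>x. c * p x)"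
| add: "trig_polynomial p \<Longrightarrow> trig_polynomial q \<Longrightarrow> trig_polynomial (\<lambda>x. p x + q x)"

lemma trig_polynomial_const: "trig_polynomial (\<lambda>x. c)"
  using trig_polynomial.scale[OF trig_polynomial.char[of 0], of c] by simp

lemma trig_polynomial_mult:
  assumes "trig_polynomial p" "trig_polynomial q"
  shows "trig_polynomial (\<lambda>x. p x * q x)"
  using assms(1)
proof induction
  case (char m)
  show ?case
    using assms(2)
  proof induction
    case (char n)
    then show ?case
      using trig_polynomial.char[of "m + n"] by (simp add: torus_char_add_index[abs_def])
  qed (auto simp: distrib_left mult.left_commute[of "torus_char m _"] intro: trig_polynomial.intros)
qed (auto simp: distrib_right mult.assoc intro: trig_polynomial.intros)

text \<open>Stone-Weierstrass is applied on the image of this map rather than on the unit cube, since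
  periodic functions do not separate opposite faces of the cube.\<close>

definition torus_embed :: "real ^ 'd \<Rightarrow> complex ^ 'd" where
  "torus_embed x = (\<chi> k. torus_char (axis k 1) x)"

lemma continuous_on_torus_embed: "continuous_on S torus_embed"
  unfolding torus_embed_def by (intro continuous_intros continuous_on_torus_char)

lemma lattice_periodic_torus_embed: "lattice_periodic torus_embed"
  by (simp add: lattice_periodic_def torus_embed_def torus_char_add torus_char_lattice_vec)

lemma torus_char_axis:
  fixes x :: "real ^ 'd"
  shows "torus_char (axis k 1) x = cis (2 * pi * x $ k)"
proof -
  have "lattice_vec (axis k 1) = (axis k 1 :: real ^ 'd)"
    by (simp add: vec_eq_iff axis_def)
  then show ?thesis
    by (simp add: torus_char_def inner_axis')
qed

lemma lattice_periodic_torus_embed_eqD: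
  assumes "torus_embed x = torus_embed y" "lattice_periodic g"
  shows "g x = g y"
proof -
  have "\<exists>n::int. x $ k = y $ k + n" for k
  proof -
    have "cis (2 * pi * x $ k) = cis (2 * pi * y $ k)"
      using assms(1) by (simp add: torus_embed_def vec_eq_iff torus_char_axis)
    then obtain n :: int where "2 * pi * x $ k = 2 * pi * y $ k + 2 * pi * n"
      using sin_cos_eq_iff by (auto simp: complex_eq_iff)
    then have "2 * pi * x $ k = 2 * pi * (y $ k + n)"
      by (simp add: distrib_left)
    then show ?thesis
      by auto
  qed
  then obtain u where "\<And>k. x $ k = y $ k + of_int (u k)"
    by metis
  then have "x = y + lattice_vec (\<chi> k. u k)"
    by (simp add: vec_eq_iff)
  then show ?thesis
    using lattice_periodic_add[OF assms(2)] by simp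
qed

lemma compact_range_torus_embed: "compact (range torus_embed)"
  unfolding lattice_periodic_range[OF lattice_periodic_torus_embed]
  by (intro compact_continuous_image continuous_on_torus_embed) auto

lemma continuous_periodic_factor_torus_embed:
  fixes g :: "real ^ 'd \<Rightarrow> 'b::topological_space"
  assumes "continuous_on UNIV g" "lattice_periodic g"
  obtains G where "continuous_on (range torus_embed) G" "\<And>x. G (torus_embed x) = g x"
proof
  define G where "G z = g (inv torus_embed z)" for z
  show G_embed: "G (torus_embed x) = g x" for x
    unfolding G_def by (rule lattice_periodic_torus_embed_eqD[OF _ assms(2)]) (simp add: f_inv_into_f)
  have "closed (G -` B \<inter> range torus_embed)" if "closed B" for B
  proof -
    have "G -` B \<inter> range torus_embed = torus_embed ` (g -` B \<inter> cbox 0 1)"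
      unfolding lattice_periodic_range[OF lattice_periodic_torus_embed] using G_embed by auto
    moreover have "compact (g -` B \<inter> cbox 0 1)"
      using assms(1) \<open>closed B\<close> by (intro closed_Int_compact closed_vimage) auto
    ultimately show ?thesis
      by (simp add: compact_imp_closed compact_continuous_image continuous_on_torus_embed)
  qed
  then show "continuous_on (range torus_embed) G"
    by (simp add: continuous_on_closed_vimage compact_imp_closed compact_range_torus_embed)
qed

lemma trig_polynomial_Re_Im_torus_char:
  "trig_polynomial (\<lambda>x. of_real (Re (torus_char m x)))"
  "trig_polynomial (\<lambda>x. of_real (Im (torus_char m x)))"
proof -
  have "trig_polynomial (\<lambda>x. 1 / 2 * torus_char m x + 1 / 2 * torus_char (- m) x)"
    "trig_polynomial (\<lambda>x. - \<i> / 2 * torus_char m x + \<i> / 2 * torus_char (- m) x)"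
    by (intro trig_polynomial.intros)+
  moreover have
    "complex_of_real (Re (torus_char m x)) = 1 / 2 * torus_char m x + 1 / 2 * torus_char (- m) x"
    "complex_of_real (Im (torus_char m x)) = - \<i> / 2 * torus_char m x + \<i> / 2 * torus_char (- m) x"
    for x
    by (simp_all add: complex_eq_iff flip: cnj_torus_char)
  ultimately show "trig_polynomial (\<lambda>x. of_real (Re (torus_char m x)))"
    "trig_polynomial (\<lambda>x. of_real (Im (torus_char m x)))"
    by (simp_all only:)
qed

lemma trig_polynomial_dense_real:
  fixes g :: "real ^ 'd \<Rightarrow> real"
  assumes "continuous_on UNIV g" "lattice_periodic g" "0 < e"
  obtains p where "trig_polynomial (\<lambda>x. of_real (p x))" "\<And>x. \<bar>g x - p x\<bar> < e"
proof -
  let ?T = "range (torus_embed :: real ^ 'd \<Rightarrow> _)"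
  let ?R = "{F. continuous_on ?T F \<and> trig_polynomial (\<lambda>x. of_real (F (torus_embed x)))}"
  interpret function_ring_on ?R ?T
  proof
    fix z w :: "complex ^ 'd" assume "z \<noteq> w"
    then obtain k where "Re (z $ k) \<noteq> Re (w $ k) \<or> Im (z $ k) \<noteq> Im (w $ k)"
      by (auto simp: vec_eq_iff complex_eq_iff)
    moreover have "continuous_on ?T (\<lambda>z. Re (z $ k))" "continuous_on ?T (\<lambda>z. Im (z $ k))"
      by (intro continuous_intros)+
    then have "(\<lambda>z. Re (z $ k)) \<in> ?R" "(\<lambda>z. Im (z $ k)) \<in> ?R"
      using trig_polynomial_Re_Im_torus_char[of "axis k 1"] by (simp_all add: torus_embed_def)
    ultimately show "\<exists>F\<in>?R. F z \<noteq> F w"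
      by (elim disjE) (erule bexI, assumption)+
  qed (auto intro: continuous_on_add continuous_on_mult continuous_on_const
      compact_range_torus_embed trig_polynomial_const trig_polynomial.add trig_polynomial_mult)
  obtain G where G: "continuous_on ?T G" "\<And>x. G (torus_embed x) = g x"
    by (rule continuous_periodic_factor_torus_embed[OF assms(1,2)]) (rule that)
  obtain F where "F \<in> ?R" "\<forall>z\<in>?T. \<bar>G z - F z\<bar> < e"
    using Stone_Weierstrass_basic[OF G(1) assms(3)] by blast
  then show thesis
    using that[of "\<lambda>x. F (torus_embed x)"] G(2) by auto
qed

theorem trig_polynomial_dense:
  assumes "continuous_on UNIV g" "lattice_periodic g" "0 < e"
  obtains p where "trig_polynomial p" "\<And>x. norm (g x - p x) < e"
proof -
  have Re_g: "continuous_on UNIV (\<lambda>x. Re (g x))" "lattice_periodic (\<lambda>x. Re (g x))"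
    and Im_g: "continuous_on UNIV (\<lambda>x. Im (g x))" "lattice_periodic (\<lambda>x. Im (g x))"
    and "0 < e / 2"
    using assms by (auto simp: lattice_periodic_def intro: continuous_on_Re continuous_on_Im)
  obtain p where p: "trig_polynomial (\<lambda>x. of_real (p x))" "\<And>x. \<bar>Re (g x) - p x\<bar> < e / 2"
    by (rule trig_polynomial_dense_real[OF Re_g \<open>0 < e / 2\<close>]) (rule that)
  obtain q where q: "trig_polynomial (\<lambda>x. of_real (q x))" "\<And>x. \<bar>Im (g x) - q x\<bar> < e / 2"
    by (rule trig_polynomial_dense_real[OF Im_g \<open>0 < e / 2\<close>]) (rule that)
  show thesis
  proof
    show "trig_polynomial (\<lambda>x. of_real (p x) + \<i> * of_real (q x))"
      by (intro trig_polynomial.add trig_polynomial.scale p q)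
    show "norm (g x - (of_real (p x) + \<i> * of_real (q x))) < e" for x
      using cmod_le[of "g x - (of_real (p x) + \<i> * of_real (q x))"] p(2)[of x] q(2)[of x] by simp
  qed
qed

subsection \<open>Fourier series\<close>

lemma has_bochner_integral_mult_trig_polynomial:
  assumes "integrable torus_uniform g" "\<And>m. torus_coeff g m = 0" "trig_polynomial p"
  shows "has_bochner_integral torus_uniform (\<lambda>x. g x * p x) 0"
  using assms(3)
proof induction
  case (char m)
  have "(\<integral>x. g x * torus_char m x \<partial>torus_uniform) = 0"
    using assms(2)[of "- m"] by (simp add: torus_coeff_def)
  then show ?case
    using integrable_mult_torus_char[OF assms(1)] by (simp add: has_bochner_integral_iff)
next
  case (scale p c)
  then show ?case
    using has_bochner_integral_mult_right[of c] by (fastforce simp: mult.left_commute)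
next
  case (add p q)
  then show ?case
    using has_bochner_integral_add by (fastforce simp: distrib_left)
qed

text \<open>As \<open>\<integral> g p = 0\<close>, the left-hand side equals \<open>\<integral> g (cnj g - p)\<close>.\<close>

lemma integral_norm_square_le_trig_approximation:
  assumes g: "bounded_torus_fun g" "\<And>m. torus_coeff g m = 0"
    and p: "trig_polynomial p" "\<And>x. norm (cnj (g x) - p x) \<le> e"
  shows "(\<integral>x. (norm (g x))\<^sup>2 \<partial>torus_uniform) \<le> e * (\<integral>x. norm (g x) \<partial>torus_uniform)"
proof -
  note integrable = integrable_bounded_torus_fun[OF g(1)]
  let ?J = "\<integral>x. (norm (g x))\<^sup>2 \<partial>torus_uniform"
  have "has_bochner_integral torus_uniform (\<lambda>x. g x * cnj (g x)) (of_real ?J)"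
    using has_bochner_integral_of_real[OF has_bochner_integral_integrable[OF
        square_integrable_bounded_torus_fun[OF g(1)]]]
    by (simp flip: complex_norm_square)
  then have residual:
      "has_bochner_integral torus_uniform (\<lambda>x. g x * (cnj (g x) - p x)) (of_real ?J)"
    using has_bochner_integral_diff[OF _
        has_bochner_integral_mult_trig_polynomial[OF integrable g(2) p(1)]]
    by (fastforce simp: right_diff_distrib)
  then have "?J = norm (\<integral>x. g x * (cnj (g x) - p x) \<partial>torus_uniform)"
    by (simp add: has_bochner_integral_iff)
  also have "\<dots> \<le> (\<integral>x. e * norm (g x) \<partial>torus_uniform)"
  proof (rule Bochner_Integration.integral_norm_bound_integral)
    show "norm (g x * (cnj (g x) - p x)) \<le> e * norm (g x)" for x
      using p(2)[of x] by (simp add: norm_mult mult.commute[of e] mult_left_mono)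
  qed (use residual integrable in \<open>auto simp: has_bochner_integral_iff\<close>)
  finally show ?thesis
    by simp
qed

lemma torus_coeff_0_imp_0:
  assumes "continuous_on UNIV g" "lattice_periodic g" "\<And>m. torus_coeff g m = 0"
  shows "g x = 0"
proof -
  let ?J = "\<integral>x. (norm (g x))\<^sup>2 \<partial>torus_uniform" and ?I = "\<integral>x. norm (g x) \<partial>torus_uniform"
  have small: "?J \<le> e * ?I" if "0 < e" for e
  proof -
    obtain p where "trig_polynomial p" "\<And>x. norm (cnj (g x) - p x) < e"
    proof (rule trig_polynomial_dense)
      show "lattice_periodic (\<lambda>x. cnj (g x))"
        using assms(2) by (simp add: lattice_periodic_def)
    qed (use assms(1) \<open>0 < e\<close> in \<open>auto intro: continuous_on_cnj\<close>)
    then show ?thesis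
      using continuous_periodic_imp_bounded_torus_fun[OF assms(1,2)] assms(3)
      by (intro integral_norm_square_le_trig_approximation) (auto intro: less_imp_le)
  qed
  have "?J = 0"
  proof (rule ccontr)
    assume "?J \<noteq> 0"
    then have "0 < ?J"
      by (simp add: less_le)
    have "0 < ?I + 1"
      by (simp add: add_nonneg_pos)
    have "?J \<le> ?J / (?I + 1) * ?I"
      using \<open>0 < ?J\<close> \<open>0 < ?I + 1\<close> by (intro small divide_pos_pos)
    also have "\<dots> < ?J"
      using \<open>0 < ?J\<close> \<open>0 < ?I + 1\<close> by (simp add: pos_divide_less_eq distrib_left)
    finally show False
      by simp
  qed
  then have "(norm (g x))\<^sup>2 = 0"
    using assms(1,2)
    by (intro continuous_torus_integral_0_imp_0[where g = "\<lambda>x. (norm (g x))\<^sup>2"])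
      (auto simp: lattice_periodic_def intro: continuous_on_power continuous_on_norm)
  then show ?thesis
    by simp
qed

definition fourier_series :: "(int ^ 'd \<Rightarrow> complex) \<Rightarrow> real ^ 'd \<Rightarrow> complex" where
  "fourier_series a x = (\<Sum>\<^sub>\<infinity>m. a m * torus_char m x)"

lemma lattice_periodic_fourier_series: "lattice_periodic (fourier_series a)"
  by (simp add: lattice_periodic_def fourier_series_def torus_char_add torus_char_lattice_vec)

context
  fixes a :: "int ^ 'd \<Rightarrow> complex"
  assumes abs_summable: "(\<lambda>m. norm (a m)) summable_on UNIV"
begin

lemma has_sum_fourier_series: "((\<lambda>m. a m * torus_char m x) has_sum fourier_series a x) UNIV"
  unfolding fourier_series_def
  by (rule has_sum_infsum, rule abs_summable_summable) (simp add: norm_mult abs_summable)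

lemma uniform_limit_fourier_series:
  "uniform_limit UNIV (trig_sum a) (fourier_series a) (finite_subsets_at_top UNIV)"
  unfolding trig_sum_def[abs_def] fourier_series_def[abs_def]
  by (rule Weierstrass_m_test_general[OF _ abs_summable]) (simp add: norm_mult)

lemma continuous_on_fourier_series: "continuous_on UNIV (fourier_series a)"
  by (rule uniform_limit_theorem[OF always_eventually uniform_limit_fourier_series])
    (simp_all add: continuous_on_trig_sum)

lemma torus_coeff_fourier_series: "torus_coeff (fourier_series a) m = a m"
proof (rule tendsto_unique)
  let ?F = "finite_subsets_at_top (UNIV :: (int ^ 'd) set)"
  show "((\<lambda>S. torus_coeff (trig_sum a S) m) \<longlongrightarrow> torus_coeff (fourier_series a) m) ?F"
    by (intro tendsto_torus_coeff uniform_limit_fourier_series always_eventually allI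
        integrable_trig_sum integrable_bounded_torus_fun continuous_periodic_imp_bounded_torus_fun
        continuous_on_fourier_series lattice_periodic_fourier_series)
  have "\<forall>\<^sub>F S in ?F. finite S \<and> m \<in> S"
    using eventually_finite_subsets_at_top by (auto intro!: exI[of _ "{m}"])
  then have "\<forall>\<^sub>F S in ?F. torus_coeff (trig_sum a S) m = a m"
    by eventually_elim (simp add: torus_coeff_trig_sum)
  then show "((\<lambda>S. torus_coeff (trig_sum a S) m) \<longlongrightarrow> a m) ?F"
    by (rule tendsto_eventually)
qed simp

end

theorem has_sum_torus_coeff:
  assumes "continuous_on UNIV g" "lattice_periodic g"
    and "(\<lambda>m. norm (torus_coeff g m)) summable_on UNIV"
  shows "((\<lambda>m. torus_coeff g m * torus_char m x) has_sum g x) UNIV"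
proof -
  let ?h = "fourier_series (torus_coeff g)"
  note series = continuous_on_fourier_series[OF assms(3)] lattice_periodic_fourier_series
  have "g x - ?h x = 0"
  proof (rule torus_coeff_0_imp_0)
    show "continuous_on UNIV (\<lambda>x. g x - ?h x)"
      by (intro continuous_intros assms(1) series(1))
    show "lattice_periodic (\<lambda>x. g x - ?h x)"
      using assms(2) series(2) by (simp add: lattice_periodic_def)
    show "torus_coeff (\<lambda>x. g x - ?h x) m = 0" for m
      using assms series
      by (subst torus_coeff_diff) (auto simp: torus_coeff_fourier_series
        intro!: integrable_bounded_torus_fun continuous_periodic_imp_bounded_torus_fun)
  qed
  then show ?thesis
    using has_sum_fourier_series[OF assms(3)] by simp
qed

subsection \<open>Convolution\<close>

definition torus_conv ::
    "(real ^ 'd \<Rightarrow> complex) \<Rightarrow> (real ^ 'd \<Rightarrow> complex) \<Rightarrow> real ^ 'd \<Rightarrow> complex" where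
  "torus_conv f g x = (\<integral>z. f (x - z) * g z \<partial>torus_uniform)"

lemma bounded_torus_fun_torus_conv:
  assumes f: "bounded_torus_fun f" and g: "bounded_torus_fun g"
  shows "bounded_torus_fun (torus_conv f g)"
proof -
  note [measurable] = bounded_torus_fun_measurable[OF f] bounded_torus_fun_measurable[OF g]
  obtain B where B: "\<And>x y. norm (f x * g y) \<le> B"
    using bounded_torus_fun_mult_bound[OF f g] by blast
  have "norm (torus_conv f g x) \<le> B" for x
  proof -
    have "norm (torus_conv f g x) \<le> (\<integral>z. norm (f (x - z) * g z) \<partial>torus_uniform)"
      unfolding torus_conv_def by (rule integral_norm_bound)
    also have "\<dots> \<le> B"
      using B by (intro torus.integral_le_const torus.integrable_const_bound[of _ B]) auto
    finally show ?thesis .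
  qed
  then have "bounded (range (torus_conv f g))"
    by (auto simp: bounded_iff)
  moreover have "lattice_periodic (torus_conv f g)"
    by (simp add: lattice_periodic_def torus_conv_def
        lattice_periodic_add_diff[OF bounded_torus_fun_periodic[OF f]])
  moreover have "torus_conv f g \<in> borel_measurable borel"
    unfolding torus_conv_def[abs_def] by measurable
  ultimately show ?thesis
    by (simp add: bounded_torus_fun_def)
qed

lemma integral_torus_reflect:
  assumes "bounded_torus_fun f"
  shows "(\<integral>y. f (x - y) \<partial>torus_uniform) = (\<integral>y. f (- y) \<partial>torus_uniform)"
proof -
  note [measurable] = bounded_torus_fun_measurable[OF assms]
  have "lattice_periodic (\<lambda>y. f (x - y))"
    by (simp add: lattice_periodic_def
        lattice_periodic_diff_add[OF bounded_torus_fun_periodic[OF assms]])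
  then have "(\<integral>y. f (x - (y + x)) \<partial>torus_uniform) = (\<integral>y. f (x - y) \<partial>torus_uniform)"
    by (intro integral_torus_translate) measurable
  then show ?thesis
    by simp
qed

lemma torus_conv_translate:
  assumes f: "bounded_torus_fun f" and g: "bounded_torus_fun g"
  shows "(\<integral>z. f (y - z) * g (z - x) \<partial>torus_uniform) = torus_conv f g (y - x)"
proof -
  note [measurable] = bounded_torus_fun_measurable[OF f] bounded_torus_fun_measurable[OF g]
  have "lattice_periodic (\<lambda>z. f (y - z) * g (z - x))"
    by (simp add: lattice_periodic_def
        lattice_periodic_add_diff[OF bounded_torus_fun_periodic[OF g]]
        lattice_periodic_diff_add[OF bounded_torus_fun_periodic[OF f]])
  then have "(\<integral>z. f (y - z) * g (z - x) \<partial>torus_uniform) =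
      (\<integral>z. f (y - (z + x)) * g (z + x - x) \<partial>torus_uniform)"
    by (intro integral_torus_translate[symmetric]) measurable
  then show ?thesis
    by (simp add: torus_conv_def algebra_simps)
qed

lemma torus_coeff_translate:
  assumes "bounded_torus_fun f"
  shows "torus_coeff (\<lambda>x. f (x - z)) m = torus_char (- m) z * torus_coeff f m"
proof -
  note [measurable] = bounded_torus_fun_measurable[OF assms]
  have "lattice_periodic (\<lambda>x. f (x - z) * torus_char (- m) x)"
    by (simp add: lattice_periodic_def
        lattice_periodic_add_diff[OF bounded_torus_fun_periodic[OF assms]]
        torus_char_add torus_char_lattice_vec)
  then have "torus_coeff (\<lambda>x. f (x - z)) m =
      (\<integral>x. f (x + z - z) * torus_char (- m) (x + z) \<partial>torus_uniform)"
    unfolding torus_coeff_def by (intro integral_torus_translate[symmetric]) measurable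
  also have "\<dots> = (\<integral>x. torus_char (- m) z * (f x * torus_char (- m) x) \<partial>torus_uniform)"
    by (simp add: torus_char_add mult_ac)
  finally show ?thesis
    by (simp add: torus_coeff_def)
qed

lemma torus_coeff_torus_conv:
  fixes f g :: "real ^ 'd \<Rightarrow> complex"
  assumes f: "bounded_torus_fun f" and g: "bounded_torus_fun g"
  shows "torus_coeff (torus_conv f g) m = torus_coeff f m * torus_coeff g m"
proof -
  note [measurable] = bounded_torus_fun_measurable[OF f] bounded_torus_fun_measurable[OF g]
  let ?U = "torus_uniform :: (real ^ 'd) measure"
  interpret product: pair_prob_space ?U ?U ..
  let ?F = "\<lambda>x z. f (x - z) * torus_char (- m) x * g z"
  obtain B where "\<And>x y. norm (f x * g y) \<le> B"
    using bounded_torus_fun_mult_bound[OF f g] by blast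
  then have integrable: "integrable (?U \<Otimes>\<^sub>M ?U) (case_prod ?F)"
    by (intro product.integrable_const_bound[of _ B]) (auto simp: norm_mult split_beta)
  have "torus_coeff (torus_conv f g) m = (\<integral>x. (\<integral>z. ?F x z \<partial>?U) \<partial>?U)"
  proof -
    have "?F x z = f (x - z) * g z * torus_char (- m) x" for x z
      by (simp add: mult_ac)
    then show ?thesis
      by (simp only: torus_coeff_def torus_conv_def integral_mult_left_zero)
  qed
  also have "\<dots> = (\<integral>z. (\<integral>x. ?F x z \<partial>?U) \<partial>?U)"
    by (rule product.Fubini_integral[symmetric, OF integrable])
  also have "\<dots> = (\<integral>z. torus_coeff (\<lambda>x. f (x - z)) m * g z \<partial>?U)"
    by (simp add: torus_coeff_def)
  also have "\<dots> = torus_coeff f m * (\<integral>z. g z * torus_char (- m) z \<partial>?U)"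
    by (simp add: torus_coeff_translate[OF f] mult.assoc mult.commute[of "torus_char _ _"])
  finally show ?thesis
    by (simp add: torus_coeff_def)
qed

lemma abs_summable_torus_coeff_torus_conv:
  assumes f: "bounded_torus_fun f" and g: "bounded_torus_fun g"
  shows "(\<lambda>m. norm (torus_coeff (torus_conv f g) m)) summable_on UNIV"
proof -
  have square_summable: "(\<lambda>m. (norm (torus_coeff f m))\<^sup>2) summable_on UNIV"
    "(\<lambda>m. (norm (torus_coeff g m))\<^sup>2) summable_on UNIV"
    by (intro square_summable_torus_coeff bounded_torus_fun_measurable
        square_integrable_bounded_torus_fun f g)+
  have "norm (torus_coeff (torus_conv f g) m) \<le>
      (norm (torus_coeff f m))\<^sup>2 + (norm (torus_coeff g m))\<^sup>2" for m
    using sum_squares_bound[of "norm (torus_coeff f m)" "norm (torus_coeff g m)"]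
      zero_le_power2[of "norm (torus_coeff f m)"] zero_le_power2[of "norm (torus_coeff g m)"]
    unfolding torus_coeff_torus_conv[OF f g] norm_mult by linarith
  then show ?thesis
    by (rule summable_on_comparison_test[OF summable_on_add[OF square_summable]]) simp_all
qed

lemma continuous_on_torus_conv:
  fixes f g :: "real ^ 'd \<Rightarrow> complex"
  assumes f: "bounded_torus_fun f" and g: "bounded_torus_fun g"
    and ae_continuous: "negligible {x. \<not> isCont f x}"
  shows "continuous_on UNIV (torus_conv f g)"
  unfolding continuous_on_eq_continuous_at[OF open_UNIV] continuous_at_sequentially
proof (intro ballI allI impI)
  fix x :: "real ^ 'd" and s :: "nat \<Rightarrow> real ^ 'd"
  assume s_tendsto: "s \<longlonglongrightarrow> x"
  note [measurable] = bounded_torus_fun_measurable[OF f] bounded_torus_fun_measurable[OF g]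
  obtain B where B: "\<And>x y. norm (f x * g y) \<le> B"
    using bounded_torus_fun_mult_bound[OF f g] by blast
  have "negligible ((\<lambda>y. x - y) ` {y. \<not> isCont f y})"
    using ae_continuous
    by (rule negligible_differentiable_image_negligible[rotated])
      (auto intro: differentiable_on_diff)
  then have AE_continuous: "AE z in torus_uniform. z \<notin> (\<lambda>y. x - y) ` {y. \<not> isCont f y}"
    by (intro AE_torus_uniformI AE_lborel_not_in_negligible)
  have "(\<lambda>n. torus_conv f g (s n)) \<longlonglongrightarrow> torus_conv f g x"
    unfolding torus_conv_def
  proof (rule integral_dominated_convergence[where w = "\<lambda>_. B"])
    show "AE z in torus_uniform. (\<lambda>n. f (s n - z) * g z) \<longlonglongrightarrow> f (x - z) * g z"
      using AE_continuous
    proof eventually_elim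
      case (elim z)
      then have "isCont f (x - z)"
        using image_eqI[of z "\<lambda>y. x - y" "x - z" "{y. \<not> isCont f y}"] by auto
      then show ?case
        by (intro tendsto_intros isCont_tendsto_compose[of "x - z" f] s_tendsto)
    qed
    show "AE z in torus_uniform. norm (f (s n - z) * g z) \<le> B" for n
      using B by simp
  qed auto
  then show "(torus_conv f g \<circ> s) \<longlonglongrightarrow> torus_conv f g x"
    by (simp add: comp_def)
qed

theorem has_sum_torus_conv:
  assumes f: "bounded_torus_fun f" and g: "bounded_torus_fun g"
    and ae_continuous: "negligible {x. \<not> isCont f x}"
  shows "((\<lambda>m. torus_coeff f m * torus_coeff g m * torus_char m x) has_sum torus_conv f g x) UNIV"
  using has_sum_torus_coeff[OF continuous_on_torus_conv[OF assms] _
      abs_summable_torus_coeff_torus_conv[OF f g], of x]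
    bounded_torus_fun_periodic[OF bounded_torus_fun_torus_conv[OF f g]]
  by (simp add: torus_coeff_torus_conv[OF f g])

lemma bounded_torus_fun_torus_conv_funpow:
  assumes "bounded_torus_fun f" "bounded_torus_fun g"
  shows "bounded_torus_fun ((torus_conv f ^^ k) g)"
  using assms by (induction k) (simp_all add: bounded_torus_fun_torus_conv)

lemma torus_coeff_torus_conv_funpow:
  assumes "bounded_torus_fun f" "bounded_torus_fun g"
  shows "torus_coeff ((torus_conv f ^^ k) g) m = torus_coeff f m ^ k * torus_coeff g m"
  by (induction k)
    (simp_all add: torus_coeff_torus_conv bounded_torus_fun_torus_conv_funpow assms mult.assoc)

definition cycle_weight ::
    "(real ^ 'd \<Rightarrow> complex) \<Rightarrow> (real ^ 'd \<Rightarrow> complex) \<Rightarrow> nat \<Rightarrow> (nat \<Rightarrow> real ^ 'd) \<Rightarrow> complex" where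
  "cycle_weight f g k x = (\<Prod>i<k. f (x i - x (Suc i))) * g (x k - x 0)"

lemma borel_measurable_cycle_weight:
  fixes f g :: "real ^ 'd \<Rightarrow> complex"
  assumes f: "bounded_torus_fun f" and g: "bounded_torus_fun g"
  shows "cycle_weight f g k \<in> borel_measurable (Pi\<^sub>M {..k} (\<lambda>_. torus_uniform))"
proof -
  note [measurable] = bounded_torus_fun_measurable[OF f] bounded_torus_fun_measurable[OF g]
  have coord: "(\<lambda>x. x i) \<in> Pi\<^sub>M {..k} (\<lambda>_. torus_uniform :: (real ^ 'd) measure) \<rightarrow>\<^sub>M borel"
    if "i \<le> k" for i
    using that
      measurable_component_singleton[of i "{..k}" "\<lambda>_. torus_uniform :: (real ^ 'd) measure"]
    by simp
  have [measurable]: "(\<lambda>x. x i) \<in> Pi\<^sub>M {..k} (\<lambda>_. torus_uniform :: (real ^ 'd) measure) \<rightarrow>\<^sub>M borel"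
    "(\<lambda>x. x (Suc i)) \<in> Pi\<^sub>M {..k} (\<lambda>_. torus_uniform :: (real ^ 'd) measure) \<rightarrow>\<^sub>M borel"
    if "i \<in> {..<k}" for i
    using that by (auto intro: coord)
  note [measurable] = coord[of 0, simplified] coord[OF order_refl]
  show ?thesis
    unfolding cycle_weight_def[abs_def] by measurable
qed

lemma integrable_cycle_weight:
  fixes f g :: "real ^ 'd \<Rightarrow> complex"
  assumes f: "bounded_torus_fun f" and g: "bounded_torus_fun g"
  shows "integrable (Pi\<^sub>M {..k} (\<lambda>_. torus_uniform)) (cycle_weight f g k)"
proof -
  interpret P: prob_space "Pi\<^sub>M {..k} (\<lambda>_. torus_uniform :: (real ^ 'd) measure)"
    by (intro prob_space_PiM torus.prob_space_axioms)
  obtain B C where bound: "0 \<le> B" "\<And>x. norm (f x) \<le> B" "\<And>x. norm (g x) \<le> C"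
    using bounded_torus_fun_bound[OF f] bounded_torus_fun_bound[OF g] by metis
  have "norm (cycle_weight f g k x) \<le> (\<Prod>i<k. B) * C" for x
    unfolding cycle_weight_def norm_mult prod_norm[symmetric]
    using bound by (intro mult_mono prod_mono prod_nonneg) auto
  then show ?thesis
    by (intro P.integrable_const_bound borel_measurable_cycle_weight f g) auto
qed

text \<open>Integrating out the last point of a path of length \<open>k + 1\<close> leaves a path of length \<open>k\<close>
  that is closed up by one more convolution.\<close>

lemma integral_cycle_weight:
  fixes f g :: "real ^ 'd \<Rightarrow> complex"
  assumes f: "bounded_torus_fun f" and g: "bounded_torus_fun g"
  shows "(\<integral>x. cycle_weight f g k x \<partial>Pi\<^sub>M {..k} (\<lambda>_. torus_uniform)) = (torus_conv f ^^ k) g 0"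
  using g
proof (induction k arbitrary: g)
  case 0
  interpret P: prob_space "Pi\<^sub>M {0::nat} (\<lambda>_. torus_uniform :: (real ^ 'd) measure)"
    by (intro prob_space_PiM torus.prob_space_axioms)
  show ?case
    using P.prob_space by (simp add: cycle_weight_def)
next
  case (Suc k)
  interpret product_sigma_finite "\<lambda>_ :: nat. torus_uniform :: (real ^ 'd) measure" ..
  let ?P = "\<lambda>k. Pi\<^sub>M {..k} (\<lambda>_. torus_uniform :: (real ^ 'd) measure)"
  have "(\<integral>x. cycle_weight f g (Suc k) x \<partial>?P (Suc k)) =
      (\<integral>x. (\<integral>z. cycle_weight f g (Suc k) (x(Suc k := z)) \<partial>torus_uniform) \<partial>?P k)"
    using integrable_cycle_weight[OF f Suc.prems, of "Suc k"]
    unfolding atMost_Suc by (intro product_integral_insert) auto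
  also have "\<dots> = (\<integral>x. cycle_weight f (torus_conv f g) k x \<partial>?P k)"
  proof (intro Bochner_Integration.integral_cong refl)
    fix x :: "nat \<Rightarrow> real ^ 'd"
    let ?prefix = "\<Prod>i<k. f (x i - x (Suc i))"
    have "cycle_weight f g (Suc k) (x(Suc k := z)) = ?prefix * (f (x k - z) * g (z - x 0))" for z
      by (simp add: cycle_weight_def mult.assoc)
    then show "(\<integral>z. cycle_weight f g (Suc k) (x(Suc k := z)) \<partial>torus_uniform) =
        cycle_weight f (torus_conv f g) k x"
      using torus_conv_translate[OF f Suc.prems, of "x k" "x 0"]
      by (simp only: cycle_weight_def) simp
  qed
  also have "\<dots> = (torus_conv f ^^ Suc k) g 0"
    using Suc.IH[OF bounded_torus_fun_torus_conv[OF f Suc.prems]] by (simp add: funpow_swap1)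
  finally show ?case .
qed

subsection \<open>Balls on the torus\<close>

lemma infdist_Ints_attained:
  fixes t :: real
  obtains n :: int where "infdist t \<int> = \<bar>t - of_int n\<bar>"
proof -
  have "\<int> \<noteq> ({} :: real set)"
    using Ints_0 by blast
  then obtain a :: real where "a \<in> \<int>" "infdist t \<int> = dist t a"
    by (rule infdist_attains_inf[OF closed_Ints])
  then show thesis
    using that by (auto simp: dist_real_def elim: Ints_cases)
qed

lemma infdist_Ints_le: "infdist t \<int> \<le> \<bar>t - of_int n\<bar>" for t :: real
  using infdist_le[of "of_int n" \<int> t] by (simp add: dist_real_def)

lemma infdist_Ints_eq_abs:
  fixes t :: real
  assumes "\<bar>t\<bar> \<le> 1/2"
  shows "infdist t \<int> = \<bar>t\<bar>"
proof (rule antisym)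
  show "infdist t \<int> \<le> \<bar>t\<bar>"
    using infdist_Ints_le[of t 0] by simp
  obtain n :: int where n: "infdist t \<int> = \<bar>t - of_int n\<bar>"
    by (rule infdist_Ints_attained)
  have "n = 0 \<or> 1 \<le> \<bar>real_of_int n\<bar>"
    by linarith
  then show "\<bar>t\<bar> \<le> infdist t \<int>"
    unfolding n using assms by (elim disjE; linarith)
qed

lemma torus_dist_attained:
  fixes x y :: "real ^ 'd"
  assumes "1 \<le> \<sigma>"
  obtains u where "torus_dist \<sigma> x y = L_norm \<sigma> (x - y - lattice_vec u)"
    "\<And>k. \<bar>(x - y - lattice_vec u) $ k\<bar> = infdist (x $ k - y $ k) \<int>"
proof -
  have "\<exists>n::int. infdist (x $ k - y $ k) \<int> = \<bar>x $ k - y $ k - of_int n\<bar>" for k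
    by (metis infdist_Ints_attained)
  then obtain n :: "'d \<Rightarrow> int"
    where n: "\<And>k. infdist (x $ k - y $ k) \<int> = \<bar>x $ k - y $ k - of_int (n k)\<bar>"
    by metis
  have least: "L_norm \<sigma> (x - y - lattice_vec (\<chi> k. n k)) \<le> L_norm \<sigma> (x - y - lattice_vec u)" for u
    using infdist_Ints_le by (intro L_norm_mono[OF assms]) (simp flip: n)
  have "torus_dist \<sigma> x y = L_norm \<sigma> (x - y - lattice_vec (\<chi> k. n k))"
    unfolding torus_dist_def using least by (intro cInf_eq_minimum) auto
  then show thesis
    by (rule that) (simp add: n)
qed

lemma torus_dist_eq_L_norm_infdist:
  fixes x y :: "real ^ 'd"
  assumes "1 \<le> \<sigma>"
  shows "torus_dist \<sigma> x y = L_norm \<sigma> (\<chi> k. infdist (x $ k - y $ k) \<int>)"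
proof -
  obtain u where u: "torus_dist \<sigma> x y = L_norm \<sigma> (x - y - lattice_vec u)"
    "\<And>k. \<bar>(x - y - lattice_vec u) $ k\<bar> = infdist (x $ k - y $ k) \<int>"
    using torus_dist_attained[OF assms] by blast
  show ?thesis
    unfolding u(1)
    by (rule L_norm_cong_abs) (simp only: u(2) vec_lambda_beta abs_of_nonneg[OF infdist_nonneg])
qed

lemma torus_dist_eq_L_norm:
  fixes x :: "real ^ 'd"
  assumes "1 \<le> \<sigma>" "\<And>k. \<bar>x $ k\<bar> \<le> 1/2"
  shows "torus_dist \<sigma> x 0 = L_norm \<sigma> x"
  unfolding torus_dist_eq_L_norm_infdist[OF assms(1)]
  by (rule L_norm_cong_abs) (simp add: infdist_Ints_eq_abs[OF assms(2)])

lemma continuous_on_torus_dist: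
  fixes y :: "real ^ 'd"
  assumes "1 \<le> \<sigma>"
  shows "continuous_on S (\<lambda>x. torus_dist \<sigma> x y)"
  unfolding torus_dist_eq_L_norm_infdist[OF assms]
  by (rule continuous_on_compose2[OF continuous_on_L_norm[OF assms, of UNIV]])
    (intro continuous_intros, simp)

lemma torus_dist_translate: "torus_dist \<sigma> (x + lattice_vec v) y = torus_dist \<sigma> x y"
proof -
  have "L_norm \<sigma> (x + lattice_vec v - y - lattice_vec u) =
      L_norm \<sigma> (x - y - lattice_vec (u - v))" for u
    using lattice_vec_add[of "u - v" v] by (simp add: algebra_simps)
  moreover have "range (\<lambda>u. L_norm \<sigma> (x - y - lattice_vec (u - v))) =
      range (\<lambda>u. L_norm \<sigma> (x - y - lattice_vec u))"
    by (auto intro: range_eqI[of _ _ "_ + v"])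
  ultimately show ?thesis
    by (simp add: torus_dist_def)
qed

lemma torus_dist_commute: "torus_dist \<sigma> x y = torus_dist \<sigma> y x"
proof -
  have "L_norm \<sigma> (x - y - lattice_vec u) = L_norm \<sigma> (y - x - lattice_vec (- u))" for u
    using L_norm_minus[of \<sigma> "x - y - lattice_vec u"] by (simp add: lattice_vec_minus algebra_simps)
  moreover have "range (\<lambda>u. L_norm \<sigma> (y - x - lattice_vec (- u))) =
      range (\<lambda>u. L_norm \<sigma> (y - x - lattice_vec u))"
    by (auto intro: range_eqI[of _ _ "- _"])
  ultimately show ?thesis
    by (simp add: torus_dist_def)
qed

definition torus_ball :: "ereal \<Rightarrow> real \<Rightarrow> (real ^ 'd) set" where
  "torus_ball \<sigma> r = {x. torus_dist \<sigma> x 0 \<le> r}"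

lemma diff_in_torus_ball_iff: "x - y \<in> torus_ball \<sigma> r \<longleftrightarrow> torus_dist \<sigma> x y \<le> r"
  by (simp add: torus_ball_def torus_dist_def)

lemma minus_in_torus_ball_iff: "- x \<in> torus_ball \<sigma> r \<longleftrightarrow> x \<in> torus_ball \<sigma> r"
  using diff_in_torus_ball_iff[of 0 x \<sigma> r] diff_in_torus_ball_iff[of x 0 \<sigma> r]
  by (simp add: torus_dist_commute)

lemma closed_torus_ball: "1 \<le> \<sigma> \<Longrightarrow> closed (torus_ball \<sigma> r)"
  unfolding torus_ball_def by (intro closed_Collect_le continuous_on_torus_dist continuous_intros)

lemma negligible_frontier_torus_ball:
  assumes "1 \<le> \<sigma>" "0 < r"
  shows "negligible (frontier (torus_ball \<sigma> r :: (real ^ 'd) set))"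
proof (rule negligible_subset)
  let ?sphere = "{x :: real ^ 'd. L_norm \<sigma> x = r}"
  show "negligible (\<Union>u. (+) (lattice_vec u) ` ?sphere)"
    using negligible_L_sphere[OF assms]
    by (intro negligible_countable_Union) (auto intro: negligible_translation)
  have "open {x :: real ^ 'd. torus_dist \<sigma> x 0 < r}"
    by (intro open_Collect_less continuous_on_torus_dist assms continuous_intros)
  then have "{x :: real ^ 'd. torus_dist \<sigma> x 0 < r} \<subseteq> interior (torus_ball \<sigma> r)"
    by (intro interior_maximal) (auto simp: torus_ball_def)
  moreover have "frontier (torus_ball \<sigma> r :: (real ^ 'd) set) =
      torus_ball \<sigma> r - interior (torus_ball \<sigma> r)"
    by (simp add: frontier_def closed_torus_ball[OF assms(1)])
  ultimately have "frontier (torus_ball \<sigma> r) \<subseteq> {x :: real ^ 'd. torus_dist \<sigma> x 0 = r}"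
    by (force simp: torus_ball_def)
  also have "\<dots> \<subseteq> (\<Union>u. (+) (lattice_vec u) ` ?sphere)"
  proof
    fix x :: "real ^ 'd" assume "x \<in> {x. torus_dist \<sigma> x 0 = r}"
    moreover obtain u where "torus_dist \<sigma> x 0 = L_norm \<sigma> (x - 0 - lattice_vec u)"
      using torus_dist_attained[OF assms(1)] by blast
    ultimately have "x - lattice_vec u \<in> ?sphere"
      by simp
    then show "x \<in> (\<Union>u. (+) (lattice_vec u) ` ?sphere)"
      by (intro UN_I[of u] image_eqI[of _ _ "x - lattice_vec u"]) auto
  qed
  finally show "frontier (torus_ball \<sigma> r) \<subseteq> (\<Union>u. (+) (lattice_vec u) ` ?sphere)" .
qed

lemma negligible_discontinuities_indicator:
  assumes "negligible (frontier A)"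
  shows "negligible {x. \<not> isCont (indicator A :: 'a::euclidean_space \<Rightarrow> complex) x}"
proof (rule negligible_subset[OF assms])
  have "indicator A = (\<lambda>x. complex_of_real (indicator A x))"
    by (simp add: fun_eq_iff indicator_def)
  then show "{x. \<not> isCont (indicator A :: 'a \<Rightarrow> complex) x} \<subseteq> frontier A"
    using isCont_indicator[where A = A] by (auto intro: continuous_of_real)
qed

lemma bounded_torus_fun_torus_ball:
  assumes "1 \<le> \<sigma>"
  shows "bounded_torus_fun (indicator (torus_ball \<sigma> r :: (real ^ 'd) set))"
  unfolding bounded_torus_fun_def
proof (intro conjI)
  show "indicator (torus_ball \<sigma> r) \<in> borel_measurable borel"
    using closed_torus_ball[OF assms] by (intro borel_measurable_indicator borel_closed)
  show "lattice_periodic (indicator (torus_ball \<sigma> r))"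
    by (simp add: lattice_periodic_def indicator_def torus_ball_def torus_dist_translate)
  show "bounded (range (indicator (torus_ball \<sigma> r) :: real ^ 'd \<Rightarrow> complex))"
    by (rule boundedI[of _ 1]) (auto simp: indicator_def)
qed

lemma torus_coeff_eq_fourier_transform:
  assumes g: "g \<in> borel_measurable borel" "lattice_periodic g"
    and f: "f \<in> borel_measurable borel"
    and cube: "\<And>x. x \<in> cbox a (a + 1) \<Longrightarrow> g x = of_real (f x)" "\<And>x. x \<notin> cbox a (a + 1) \<Longrightarrow> f x = 0"
  shows "torus_coeff g m = fourier_transform f ((2 * pi) *\<^sub>R lattice_vec m)"
proof -
  note [measurable] = g(1) f
  let ?wave = "\<lambda>x. exp (- \<i> * complex_of_real (((2 * pi) *\<^sub>R lattice_vec m) \<bullet> x))"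
  have wave: "torus_char (- m) x = ?wave x" for x
    by (simp add: torus_char_def lattice_vec_minus cis_conv_exp)
  have "torus_coeff g m = (LINT x : cbox a (a + 1) | lborel. g x * torus_char (- m) x)"
    unfolding torus_coeff_def using lattice_periodic_add[OF g(2)]
    by (intro integral_torus_eq_unit_cube)
      (auto simp: lattice_periodic_def torus_char_add torus_char_lattice_vec)
  also have "\<dots> = (\<integral>x. ?wave x * of_real (f x) \<partial>lborel)"
    unfolding set_lebesgue_integral_def
    by (intro Bochner_Integration.integral_cong) (auto simp: wave cube indicator_def)
  also have "\<dots> = fourier_transform f ((2 * pi) *\<^sub>R lattice_vec m)"
    unfolding fourier_transform_def by (rule integral_completion[symmetric]) measurable
  finally show ?thesis .
qed

lemma torus_coeff_torus_ball:
  fixes m :: "int ^ 'd"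
  assumes "1 \<le> \<sigma>" "r \<le> 1/2"
  shows "torus_coeff (indicator (torus_ball \<sigma> r)) m =
    fourier_transform (indicator (L_ball \<sigma> r)) ((2 * pi) *\<^sub>R lattice_vec m)"
proof (rule torus_coeff_eq_fourier_transform[where a = "- vec (1/2)"])
  let ?cube = "cbox (- vec (1/2)) (- vec (1/2) + 1) :: (real ^ 'd) set"
  note [measurable] = borel_measurable_L_norm[OF assms(1)]
  show "indicator (L_ball \<sigma> r) \<in> borel_measurable (borel :: (real ^ 'd) measure)"
    unfolding L_ball_def by measurable
  have mem_cube: "x \<in> ?cube \<longleftrightarrow> (\<forall>k. \<bar>x $ k\<bar> \<le> 1/2)" for x
  proof -
    have "- (1/2) \<le> x $ k \<and> x $ k \<le> - (1/2) + 1 \<longleftrightarrow> \<bar>x $ k\<bar> \<le> 1/2" for k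
      by linarith
    then show ?thesis
      by (simp add: mem_box_cart)
  qed
  show "indicator (torus_ball \<sigma> r) x = complex_of_real (indicator (L_ball \<sigma> r) x)"
    if "x \<in> ?cube" for x
    using torus_dist_eq_L_norm[OF assms(1), of x] that[unfolded mem_cube]
    by (simp add: torus_ball_def L_ball_def indicator_def)
  show "indicat_real (L_ball \<sigma> r) x = 0" if "x \<notin> ?cube" for x
  proof -
    have "\<not> (\<forall>k. \<bar>x $ k\<bar> \<le> 1/2)"
      using that mem_cube by blast
    then obtain k where "1/2 < \<bar>x $ k\<bar>"
      by (meson not_le)
    also have "\<dots> \<le> L_norm \<sigma> x"
      by (rule component_le_L_norm[OF assms(1)])
    finally show ?thesis
      using assms(2) by (simp add: L_ball_def indicator_def)
  qed
qed (use bounded_torus_fun_torus_ball[OF assms(1)] in \<open>auto simp: bounded_torus_fun_def\<close>)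

subsection \<open>The geometric random graph\<close>

lemma integral_complex_indicator:
  "(\<integral>x. indicator A x \<partial>M) = complex_of_real (measure M (A \<inter> space M))"
proof -
  have "(\<integral>x. indicator A x \<partial>M) = (\<integral>x. complex_of_real (indicator A x) \<partial>M)"
    by (intro Bochner_Integration.integral_cong) (simp_all add: indicator_def)
  then show ?thesis
    by simp
qed

lemma edge_probability_eq_torus_conv:
  fixes r :: real
  assumes "1 \<le> \<sigma>"
  defines "f \<equiv> indicator (torus_ball \<sigma> r) :: real ^ 'd \<Rightarrow> complex"
  shows "of_real (edge_probability TYPE('d) \<sigma> r) = torus_conv f f 0"
proof -
  let ?U = "torus_uniform :: (real ^ 'd) measure"
  interpret product: pair_prob_space ?U ?U ..
  have f: "bounded_torus_fun f"
    unfolding f_def by (rule bounded_torus_fun_torus_ball[OF assms(1)])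
  note [measurable] = bounded_torus_fun_measurable[OF f]
  have even: "f (- x) = f x" and idempotent: "f x * f x = f x" and norm_f: "norm (f x) \<le> 1" for x
    by (simp_all add: f_def indicator_def minus_in_torus_ball_iff)
  have indicator_edge: "indicator {(x, y). torus_dist \<sigma> x y \<le> r} = (\<lambda>(x, y). f (x - y))"
    by (auto simp: f_def indicator_def diff_in_torus_ball_iff)
  have integrable: "integrable (?U \<Otimes>\<^sub>M ?U) (\<lambda>(x, y). f (x - y))"
    using norm_f by (intro product.integrable_const_bound[of _ 1]) auto
  have "complex_of_real (edge_probability TYPE('d) \<sigma> r) = (\<integral>z. (\<lambda>(x, y). f (x - y)) z \<partial>(?U \<Otimes>\<^sub>M ?U))"
    unfolding edge_probability_def indicator_edge[symmetric] integral_complex_indicator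
    by (simp add: space_pair_measure)
  also have "\<dots> = (\<integral>x. (\<integral>y. f (x - y) \<partial>?U) \<partial>?U)"
    using product.integral_fst[OF integrable] by simp
  also have "\<dots> = (\<integral>y. f y \<partial>?U)"
    using torus.prob_space[where 'd = 'd] by (simp add: integral_torus_reflect[OF f] even)
  also have "\<dots> = torus_conv f f 0"
    by (simp add: torus_conv_def even idempotent)
  finally show ?thesis .
qed

lemma (in prob_space) distr_indep_vars_reindex:
  assumes "indep_vars (\<lambda>_. S) X J" "\<And>i. i \<in> J \<Longrightarrow> distr M S (X i) = N"
    and "inj_on p K" "p ` K \<subseteq> J" "K \<noteq> {}"
  shows "distr M (Pi\<^sub>M K (\<lambda>_. S)) (\<lambda>\<omega>. \<lambda>j\<in>K. X (p j) \<omega>) = Pi\<^sub>M K (\<lambda>_. N)"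
proof -
  have rv: "X i \<in> M \<rightarrow>\<^sub>M S" if "i \<in> J" for i
    using assms(1) that by (simp add: indep_vars_def)
  obtain i where "i \<in> J"
    using assms(4,5) by blast
  have [measurable_cong]: "sets N = sets S"
    using assms(2)[OF \<open>i \<in> J\<close>] by (metis sets_distr)
  have "prob_space N"
    using assms(2)[OF \<open>i \<in> J\<close>] prob_space_distr[OF rv[OF \<open>i \<in> J\<close>]] by simp
  let ?joint = "\<lambda>\<omega>. \<lambda>i\<in>p ` K. X i \<omega>"
  have "distr M (Pi\<^sub>M (p ` K) (\<lambda>_. S)) ?joint = Pi\<^sub>M (p ` K) (\<lambda>i. distr M S (X i))"
    using indep_vars_subset[OF assms(1,4)] assms(4,5) rv
    by (subst indep_vars_iff_distr_eq_PiM'[symmetric]) auto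
  also have "\<dots> = Pi\<^sub>M (p ` K) (\<lambda>_. N)"
    using assms(2,4) by (intro PiM_cong) auto
  finally have joint: "distr M (Pi\<^sub>M (p ` K) (\<lambda>_. S)) ?joint = Pi\<^sub>M (p ` K) (\<lambda>_. N)" .
  have "distr M (Pi\<^sub>M K (\<lambda>_. S)) (\<lambda>\<omega>. \<lambda>j\<in>K. X (p j) \<omega>) =
      distr M (Pi\<^sub>M K (\<lambda>_. S)) ((\<lambda>x. \<lambda>j\<in>K. x (p j)) \<circ> ?joint)"
    by (intro distr_cong) (auto simp: fun_eq_iff)
  also have "\<dots> = distr (Pi\<^sub>M (p ` K) (\<lambda>_. N)) (Pi\<^sub>M K (\<lambda>_. S)) (\<lambda>x. \<lambda>j\<in>K. x (p j))"
    unfolding joint[symmetric] using rv assms(4)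
    by (intro distr_distr[symmetric])
      (auto intro!: measurable_restrict measurable_component_singleton)
  also have "\<dots> = distr (Pi\<^sub>M (p ` K) (\<lambda>_. N)) (Pi\<^sub>M K (\<lambda>_. N)) (\<lambda>x. \<lambda>j\<in>K. x (p j))"
    by (intro distr_cong sets_PiM_cong) (simp_all add: \<open>sets N = sets S\<close>)
  also have "\<dots> = Pi\<^sub>M K (\<lambda>_. N)"
    using \<open>prob_space N\<close> assms(3) by (intro distr_PiM_reindex) auto
  finally show ?thesis .
qed

lemma geometric_graph_edges_iff:
  assumes "i \<in> {1..n}" "j \<in> {1..n}" "i \<noteq> j"
  shows "{i, j} \<in> geometric_graph_edges \<sigma> r n x \<longleftrightarrow> x i - x j \<in> torus_ball \<sigma> r"
  using assms torus_dist_commute[of \<sigma> "x i" "x j"]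
  by (auto simp: geometric_graph_edges_def diff_in_torus_ball_iff doubleton_eq_iff)

lemma labeled_cycleD:
  assumes "labeled_cycle V (Suc k) ys"
  shows "length ys = Suc k" "inj_on ((!) ys) {..k}" "(!) ys ` {..k} \<subseteq> V"
  using assms nth_mem[of _ ys]
  by (auto simp: labeled_cycle_def inj_on_def nth_eq_iff_index_eq less_Suc_eq_le subset_eq)

lemma cycle_present_geometric_graph_iff:
  assumes "labeled_cycle {1..n} (Suc k) ys" "1 \<le> k"
  shows "cycle_present (geometric_graph_edges \<sigma> r n x) ys \<longleftrightarrow>
    (\<forall>i<k. x (ys ! i) - x (ys ! Suc i) \<in> torus_ball \<sigma> r) \<and>
    x (ys ! k) - x (ys ! 0) \<in> torus_ball \<sigma> r"
proof -
  note ys = labeled_cycleD[OF assms(1)]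
  have edge: "{ys ! i, ys ! j} \<in> geometric_graph_edges \<sigma> r n x \<longleftrightarrow>
      x (ys ! i) - x (ys ! j) \<in> torus_ball \<sigma> r" if "i \<le> k" "j \<le> k" "i \<noteq> j" for i j
    using that ys(2,3)
    by (intro geometric_graph_edges_iff) (auto simp: inj_on_eq_iff image_subset_iff)
  have "ys \<noteq> []"
    using ys(1) by auto
  then have "hd ys = ys ! 0" "last ys = ys ! k"
    by (simp_all add: hd_conv_nth last_conv_nth ys(1))
  then show ?thesis
    using assms(2) by (auto simp: cycle_present_def ys(1) edge)
qed

lemma cycle_weight_indicator_torus_ball:
  assumes "labeled_cycle {1..n} (Suc k) ys" "1 \<le> k"
  shows "cycle_weight (indicator (torus_ball \<sigma> r)) (indicator (torus_ball \<sigma> r)) k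
      (\<lambda>i\<in>{..k}. x (ys ! i)) =
    of_bool (cycle_present (geometric_graph_edges \<sigma> r n x) ys)"
  unfolding cycle_weight_def cycle_present_geometric_graph_iff[OF assms]
  by (auto simp: indicator_def)

lemma cycle_probability_eq_torus_conv:
  fixes X :: "nat \<Rightarrow> 'a \<Rightarrow> real ^ 'd" and r :: real
  assumes "1 \<le> \<sigma>" "2 \<le> q" "prob_space M"
    and indep: "prob_space.indep_vars M (\<lambda>_. borel) X {1..n}"
    and uniform: "\<And>i. i \<in> {1..n} \<Longrightarrow> distr M borel (X i) = torus_uniform"
    and cycle: "labeled_cycle {1..n} q ys"
  defines "f \<equiv> indicator (torus_ball \<sigma> r) :: real ^ 'd \<Rightarrow> complex"
  shows "of_real (cycle_probability M (\<lambda>\<omega>. geometric_graph_edges \<sigma> r n (\<lambda>i. X i \<omega>)) ys) =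
    (torus_conv f ^^ (q - 1)) f 0"
proof -
  interpret M: prob_space M
    by fact
  define k where "k = q - 1"
  then have q: "q = Suc k" "1 \<le> k"
    using assms(2) by auto
  note ys = labeled_cycleD[OF cycle[unfolded q(1)]]
  have f: "bounded_torus_fun f"
    unfolding f_def by (rule bounded_torus_fun_torus_ball[OF assms(1)])
  let ?points = "\<lambda>\<omega>. \<lambda>i\<in>{..k}. X (ys ! i) \<omega>"
  let ?present = "{\<omega> \<in> space M. cycle_present (geometric_graph_edges \<sigma> r n (\<lambda>i. X i \<omega>)) ys}"
  have points: "?points \<in> M \<rightarrow>\<^sub>M Pi\<^sub>M {..k} (\<lambda>_. borel)"
    using indep ys(3) by (intro measurable_restrict) (auto simp: M.indep_vars_def image_subset_iff)
  have weight: "cycle_weight f f k \<in> borel_measurable (Pi\<^sub>M {..k} (\<lambda>_. borel))"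
    using borel_measurable_cycle_weight[OF f f, of k]
    by (simp cong: measurable_cong_sets sets_PiM_cong)
  have distr_points: "distr M (Pi\<^sub>M {..k} (\<lambda>_. borel)) ?points = Pi\<^sub>M {..k} (\<lambda>_. torus_uniform)"
    using ys(2,3) by (intro M.distr_indep_vars_reindex[OF indep uniform]) auto
  have "complex_of_real (cycle_probability M (\<lambda>\<omega>. geometric_graph_edges \<sigma> r n (\<lambda>i. X i \<omega>)) ys) =
      (\<integral>\<omega>. indicator ?present \<omega> \<partial>M)"
    unfolding integral_complex_indicator cycle_probability_def by (simp add: Int_absorb2 subset_eq)
  also have "\<dots> = (\<integral>\<omega>. cycle_weight f f k (?points \<omega>) \<partial>M)"
    unfolding f_def
    using cycle_weight_indicator_torus_ball[OF cycle[unfolded q(1)] q(2), of \<sigma> r "\<lambda>i. X i _"]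
    by (intro Bochner_Integration.integral_cong) (simp_all add: indicator_def)
  also have "\<dots> = (\<integral>x. cycle_weight f f k x \<partial>distr M (Pi\<^sub>M {..k} (\<lambda>_. borel)) ?points)"
    by (rule integral_distr[OF points weight, symmetric])
  also have "\<dots> = (torus_conv f ^^ k) f 0"
    unfolding distr_points by (rule integral_cycle_weight[OF f f])
  finally show ?thesis
    by (simp add: k_def)
qed

theorem theorem1:
  fixes \<sigma> :: ereal and r :: real and n q :: nat
    and M :: "'a measure" and X :: "nat \<Rightarrow> 'a \<Rightarrow> real ^ 'd" and ys :: "nat list"
  assumes "1 \<le> \<sigma>" and "0 < r" and "r \<le> 1 / 2" and "2 \<le> q" and "q \<le> n"
    and "prob_space M"
    and "prob_space.indep_vars M (\<lambda>_. borel) X {1..n}"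
    and "\<And>i. i \<in> {1..n} \<Longrightarrow> distr M borel (X i) = torus_uniform"
    and "labeled_cycle {1..n} q ys"
  shows "let \<Theta> = cycle_probability M (\<lambda>\<omega>. geometric_graph_edges \<sigma> r n (\<lambda>i. X i \<omega>)) ys in
         (q = 2 \<longrightarrow> \<Theta> = edge_probability TYPE('d) \<sigma> r) \<and>
         (q > 2 \<longrightarrow>
           ((\<lambda>m :: int ^ 'd.
               fourier_transform (indicator (L_ball \<sigma> r)) ((2 * pi) *\<^sub>R lattice_vec m) ^ q)
             has_sum complex_of_real \<Theta>) UNIV)"
proof -
  define f where "f = (indicator (torus_ball \<sigma> r) :: real ^ 'd \<Rightarrow> complex)"
  define \<Theta> where "\<Theta> = cycle_probability M (\<lambda>\<omega>. geometric_graph_edges \<sigma> r n (\<lambda>i. X i \<omega>)) ys"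
  have f: "bounded_torus_fun f"
    unfolding f_def by (rule bounded_torus_fun_torus_ball[OF assms(1)])
  have \<Theta>: "of_real \<Theta> = (torus_conv f ^^ (q - 1)) f 0"
    unfolding \<Theta>_def f_def using assms by (intro cycle_probability_eq_torus_conv)
  obtain k where k: "q = Suc (Suc k)"
    using assms(4) by (metis add_2_eq_Suc le_Suc_ex)
  have "((\<lambda>m. torus_coeff f m * torus_coeff ((torus_conv f ^^ k) f) m * torus_char m 0) has_sum
      torus_conv f ((torus_conv f ^^ k) f) 0) UNIV"
    unfolding f_def
    by (intro has_sum_torus_conv bounded_torus_fun_torus_conv_funpow bounded_torus_fun_torus_ball
        negligible_discontinuities_indicator negligible_frontier_torus_ball assms)
  then have "((\<lambda>m. torus_coeff f m ^ q) has_sum of_real \<Theta>) UNIV"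
    by (simp add: k \<Theta> torus_coeff_torus_conv_funpow[OF f f] mult.left_commute mult.commute)
  moreover have "of_real \<Theta> = complex_of_real (edge_probability TYPE('d) \<sigma> r)" if "q = 2"
    using that \<Theta> edge_probability_eq_torus_conv[OF assms(1), where 'd = 'd and r = r]
    by (simp add: f_def)
  ultimately show ?thesis
    unfolding \<Theta>_def f_def torus_coeff_torus_ball[OF assms(1,3)] Let_def by auto
qed

end
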